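(* Let $(\mathcal{M},\otimes,\mathbf{1},\sigma)$ be a braided monoidal category with equalizers and coequalizers that are preserved by $\otimes$. Given morphisms $f,g:A\to B$ in $\mathsf{Hopf}(\mathcal{M})$, let $\phi_f:=m_B(m_B\otimes\mathrm{Id}_B)(\mathrm{Id}_B\otimes f\otimes\mathrm{Id}_B)$ and $\phi_g:=m_B(m_B\otimes\mathrm{Id}_B)(\mathrm{Id}_B\otimes g\otimes\mathrm{Id}_B)$, both $B\otimes A\otimes B\to B$, and let $\pi:B\to\mathsf{Coeq}(\phi_f,\phi_g)$ be the coequalizer of $(\phi_f,\phi_g)$ in $\mathcal{M}$. Then $\pi:B\to\mathsf{Coeq}(\phi_f,\phi_g)$ is the coequalizer of $(f,g)$ in $\mathsf{Hopf}(\mathcal{M})$. The same happens for the category $\mathsf{Hopf}_{\mathrm{coc}}(\mathcal{M})$: if $f,g$ are morphisms in $\mathsf{Hopf}_{\mathrm{coc}}(\mathcal{M})$, then $\pi$ is the coequalizer of $(f,g)$ in $\mathsf{Hopf}_{\mathrm{coc}}(\mathcal{M})$.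
   Context: Associativity and unit constraints are suppressed. "Preserved by $\otimes$" means preserved by $M\otimes(-)$ and $(-)\otimes M$ for every object $M$. $\mathsf{Hopf}(\mathcal{M})$ is the category of Hopf monoids $(A,m_A,u_A,\Delta_A,\varepsilon_A,S_A)$ in $\mathcal{M}$ with Hopf monoid morphisms, and $\mathsf{Hopf}_{\mathrm{coc}}(\mathcal{M})$ is its full subcategory of cocommutative ones, $\sigma_{A,A}\Delta_A=\Delta_A$. The object $\mathsf{Coeq}(\phi_f,\phi_g)$ is regarded as a Hopf monoid with the unique structure for which $\pi$ is a morphism of Hopf monoids. *)

theory Defs
  imports Main
begin

section \<open>Categories\<close>

text \<open>
  A category is given by a set of objects and a set of arrows inside two arbitrary types. The
  composite \<open>g \<cdot> f\<close> is meaningful only for arrows with \<open>Cod f = Dom g\<close>; all operations are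
  unconstrained outside the objects and arrows.
\<close>

record ('o, 'm) category_data =
  Obj :: "'o set"
  Arr :: "'m set"
  Dom :: "'m \<Rightarrow> 'o"
  Cod :: "'m \<Rightarrow> 'o"
  Idt :: "'o \<Rightarrow> 'm"
  Comp :: "'m \<Rightarrow> 'm \<Rightarrow> 'm"  (infixr "\<cdot>\<index>" 65)

definition hom :: "('o, 'm, 'x) category_data_scheme \<Rightarrow> 'o \<Rightarrow> 'o \<Rightarrow> 'm set"
  where "hom C X Y = {f \<in> Arr C. Dom C f = X \<and> Cod C f = Y}"

locale category =
  fixes C :: "('o, 'm, 'x) category_data_scheme" (structure)
  assumes dom_obj: "f \<in> Arr C \<Longrightarrow> Dom C f \<in> Obj C"
    and cod_obj: "f \<in> Arr C \<Longrightarrow> Cod C f \<in> Obj C"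
    and idt_hom: "X \<in> Obj C \<Longrightarrow> Idt C X \<in> hom C X X"
    and comp_hom: "f \<in> hom C X Y \<Longrightarrow> g \<in> hom C Y Z \<Longrightarrow> g \<cdot> f \<in> hom C X Z"
    and comp_idt: "f \<in> hom C X Y \<Longrightarrow> f \<cdot> Idt C X = f"
    and idt_comp: "f \<in> hom C X Y \<Longrightarrow> Idt C Y \<cdot> f = f"
    and comp_assoc: "f \<in> hom C W X \<Longrightarrow> g \<in> hom C X Y \<Longrightarrow> h \<in> hom C Y Z \<Longrightarrow>
      (h \<cdot> g) \<cdot> f = h \<cdot> (g \<cdot> f)"

definition inverse_arrows :: "('o, 'm, 'x) category_data_scheme \<Rightarrow> 'm \<Rightarrow> 'm \<Rightarrow> bool"
  where "inverse_arrows C f g \<longleftrightarrow>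
    f \<in> Arr C \<and> g \<in> hom C (Cod C f) (Dom C f) \<and>
    g \<cdot>\<^bsub>C\<^esub> f = Idt C (Dom C f) \<and> f \<cdot>\<^bsub>C\<^esub> g = Idt C (Cod C f)"

definition iso_arrow :: "('o, 'm, 'x) category_data_scheme \<Rightarrow> 'm \<Rightarrow> bool"
  where "iso_arrow C f \<longleftrightarrow> (\<exists>g. inverse_arrows C f g)"

definition inv_arrow :: "('o, 'm, 'x) category_data_scheme \<Rightarrow> 'm \<Rightarrow> 'm"
  where "inv_arrow C f = (THE g. inverse_arrows C f g)"

definition parallel :: "('o, 'm, 'x) category_data_scheme \<Rightarrow> 'm \<Rightarrow> 'm \<Rightarrow> bool"
  where "parallel C f g \<longleftrightarrow>
    f \<in> Arr C \<and> g \<in> Arr C \<and> Dom C f = Dom C g \<and> Cod C f = Cod C g"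

definition is_equalizer :: "('o, 'm, 'x) category_data_scheme \<Rightarrow> 'm \<Rightarrow> 'm \<Rightarrow> 'm \<Rightarrow> bool"
  where "is_equalizer C f g e \<longleftrightarrow>
    parallel C f g \<and> e \<in> Arr C \<and> Cod C e = Dom C f \<and> f \<cdot>\<^bsub>C\<^esub> e = g \<cdot>\<^bsub>C\<^esub> e \<and>
    (\<forall>h \<in> Arr C. Cod C h = Dom C f \<and> f \<cdot>\<^bsub>C\<^esub> h = g \<cdot>\<^bsub>C\<^esub> h \<longrightarrow>
      (\<exists>!k. k \<in> hom C (Dom C h) (Dom C e) \<and> e \<cdot>\<^bsub>C\<^esub> k = h))"

definition is_coequalizer :: "('o, 'm, 'x) category_data_scheme \<Rightarrow> 'm \<Rightarrow> 'm \<Rightarrow> 'm \<Rightarrow> bool"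
  where "is_coequalizer C f g q \<longleftrightarrow>
    parallel C f g \<and> q \<in> Arr C \<and> Dom C q = Cod C f \<and> q \<cdot>\<^bsub>C\<^esub> f = q \<cdot>\<^bsub>C\<^esub> g \<and>
    (\<forall>h \<in> Arr C. Dom C h = Cod C f \<and> h \<cdot>\<^bsub>C\<^esub> f = h \<cdot>\<^bsub>C\<^esub> g \<longrightarrow>
      (\<exists>!k. k \<in> hom C (Cod C q) (Cod C h) \<and> k \<cdot>\<^bsub>C\<^esub> q = h))"

definition has_equalizers :: "('o, 'm, 'x) category_data_scheme \<Rightarrow> bool"
  where "has_equalizers C \<longleftrightarrow> (\<forall>f g. parallel C f g \<longrightarrow> (\<exists>e. is_equalizer C f g e))"

definition has_coequalizers :: "('o, 'm, 'x) category_data_scheme \<Rightarrow> bool"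
  where "has_coequalizers C \<longleftrightarrow> (\<forall>f g. parallel C f g \<longrightarrow> (\<exists>q. is_coequalizer C f g q))"

definition full_subcategory ::
    "('o, 'm, 'x) category_data_scheme \<Rightarrow> ('o \<Rightarrow> bool) \<Rightarrow> ('o, 'm, 'x) category_data_scheme"
  where "full_subcategory C P =
    C\<lparr>Obj := {X \<in> Obj C. P X}, Arr := {f \<in> Arr C. P (Dom C f) \<and> P (Cod C f)}\<rparr>"


section \<open>Braided monoidal categories\<close>

text \<open>
  The tensor product acts on objects (\<open>\<odot>\<close>) and on arrows (\<open>\<otimes>\<close>). No strictness is assumed. The
  constraints are
  \<^item> \<open>Asc M X Y Z : (X \<odot> Y) \<odot> Z \<rightarrow> X \<odot> (Y \<odot> Z)\<close>,
  \<^item> \<open>Lu M X : \<one> \<odot> X \<rightarrow> X\<close> and \<open>Ru M X : X \<odot> \<one> \<rightarrow> X\<close>,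
  \<^item> \<open>Br M X Y : X \<odot> Y \<rightarrow> Y \<odot> X\<close>.
\<close>

record ('o, 'm) braided_data = "('o, 'm) category_data" +
  TensO :: "'o \<Rightarrow> 'o \<Rightarrow> 'o"  (infixr "\<odot>\<index>" 70)
  TensA :: "'m \<Rightarrow> 'm \<Rightarrow> 'm"  (infixr "\<otimes>\<index>" 70)
  UnitO :: 'o  ("\<one>\<index>")
  Asc :: "'o \<Rightarrow> 'o \<Rightarrow> 'o \<Rightarrow> 'm"
  Lu :: "'o \<Rightarrow> 'm"
  Ru :: "'o \<Rightarrow> 'm"
  Br :: "'o \<Rightarrow> 'o \<Rightarrow> 'm"

locale monoidal_category = category M
  for M :: "('o, 'm, 'x) braided_data_scheme" (structure) +
  assumes tens_obj: "X \<in> Obj M \<Longrightarrow> Y \<in> Obj M \<Longrightarrow> X \<odot> Y \<in> Obj M"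
    and tens_hom: "f \<in> hom M X X' \<Longrightarrow> g \<in> hom M Y Y' \<Longrightarrow> f \<otimes> g \<in> hom M (X \<odot> Y) (X' \<odot> Y')"
    and tens_idt: "X \<in> Obj M \<Longrightarrow> Y \<in> Obj M \<Longrightarrow> Idt M X \<otimes> Idt M Y = Idt M (X \<odot> Y)"
    and tens_comp: "f \<in> hom M X X' \<Longrightarrow> f' \<in> hom M X' X'' \<Longrightarrow>
      g \<in> hom M Y Y' \<Longrightarrow> g' \<in> hom M Y' Y'' \<Longrightarrow>
      (f' \<cdot> f) \<otimes> (g' \<cdot> g) = (f' \<otimes> g') \<cdot> (f \<otimes> g)"
    and unit_obj: "\<one> \<in> Obj M"
    and asc_hom: "X \<in> Obj M \<Longrightarrow> Y \<in> Obj M \<Longrightarrow> Z \<in> Obj M \<Longrightarrow>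
      Asc M X Y Z \<in> hom M ((X \<odot> Y) \<odot> Z) (X \<odot> (Y \<odot> Z))"
    and asc_iso: "X \<in> Obj M \<Longrightarrow> Y \<in> Obj M \<Longrightarrow> Z \<in> Obj M \<Longrightarrow> iso_arrow M (Asc M X Y Z)"
    and asc_natural: "f \<in> hom M X X' \<Longrightarrow> g \<in> hom M Y Y' \<Longrightarrow> h \<in> hom M Z Z' \<Longrightarrow>
      Asc M X' Y' Z' \<cdot> ((f \<otimes> g) \<otimes> h) = (f \<otimes> (g \<otimes> h)) \<cdot> Asc M X Y Z"
    and lu_hom: "X \<in> Obj M \<Longrightarrow> Lu M X \<in> hom M (\<one> \<odot> X) X"
    and lu_iso: "X \<in> Obj M \<Longrightarrow> iso_arrow M (Lu M X)"
    and lu_natural: "f \<in> hom M X Y \<Longrightarrow> Lu M Y \<cdot> (Idt M \<one> \<otimes> f) = f \<cdot> Lu M X"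
    and ru_hom: "X \<in> Obj M \<Longrightarrow> Ru M X \<in> hom M (X \<odot> \<one>) X"
    and ru_iso: "X \<in> Obj M \<Longrightarrow> iso_arrow M (Ru M X)"
    and ru_natural: "f \<in> hom M X Y \<Longrightarrow> Ru M Y \<cdot> (f \<otimes> Idt M \<one>) = f \<cdot> Ru M X"
    and pentagon: "W \<in> Obj M \<Longrightarrow> X \<in> Obj M \<Longrightarrow> Y \<in> Obj M \<Longrightarrow> Z \<in> Obj M \<Longrightarrow>
      Asc M W X (Y \<odot> Z) \<cdot> Asc M (W \<odot> X) Y Z =
      (Idt M W \<otimes> Asc M X Y Z) \<cdot> Asc M W (X \<odot> Y) Z \<cdot> (Asc M W X Y \<otimes> Idt M Z)"
    and triangle: "X \<in> Obj M \<Longrightarrow> Y \<in> Obj M \<Longrightarrow>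
      (Idt M X \<otimes> Lu M Y) \<cdot> Asc M X \<one> Y = Ru M X \<otimes> Idt M Y"

locale braided_monoidal_category = monoidal_category +
  assumes br_hom: "X \<in> Obj M \<Longrightarrow> Y \<in> Obj M \<Longrightarrow> Br M X Y \<in> hom M (X \<odot> Y) (Y \<odot> X)"
    and br_iso: "X \<in> Obj M \<Longrightarrow> Y \<in> Obj M \<Longrightarrow> iso_arrow M (Br M X Y)"
    and br_natural: "f \<in> hom M X X' \<Longrightarrow> g \<in> hom M Y Y' \<Longrightarrow>
      Br M X' Y' \<cdot> (f \<otimes> g) = (g \<otimes> f) \<cdot> Br M X Y"
    and hexagon1: "X \<in> Obj M \<Longrightarrow> Y \<in> Obj M \<Longrightarrow> Z \<in> Obj M \<Longrightarrow>
      Asc M Y Z X \<cdot> Br M X (Y \<odot> Z) \<cdot> Asc M X Y Z =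
      (Idt M Y \<otimes> Br M X Z) \<cdot> Asc M Y X Z \<cdot> (Br M X Y \<otimes> Idt M Z)"
    and hexagon2: "X \<in> Obj M \<Longrightarrow> Y \<in> Obj M \<Longrightarrow> Z \<in> Obj M \<Longrightarrow>
      inv_arrow M (Asc M Z X Y) \<cdot> Br M (X \<odot> Y) Z \<cdot> inv_arrow M (Asc M X Y Z) =
      (Br M X Z \<otimes> Idt M Y) \<cdot> inv_arrow M (Asc M X Z Y) \<cdot> (Idt M X \<otimes> Br M Y Z)"

definition tensor_preserves_equalizers :: "('o, 'm, 'x) braided_data_scheme \<Rightarrow> bool"
  where "tensor_preserves_equalizers M \<longleftrightarrow>
    (\<forall>X \<in> Obj M. \<forall>f g e. is_equalizer M f g e \<longrightarrow>
      is_equalizer M (Idt M X \<otimes>\<^bsub>M\<^esub> f) (Idt M X \<otimes>\<^bsub>M\<^esub> g) (Idt M X \<otimes>\<^bsub>M\<^esub> e) \<and>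
      is_equalizer M (f \<otimes>\<^bsub>M\<^esub> Idt M X) (g \<otimes>\<^bsub>M\<^esub> Idt M X) (e \<otimes>\<^bsub>M\<^esub> Idt M X))"

definition tensor_preserves_coequalizers :: "('o, 'm, 'x) braided_data_scheme \<Rightarrow> bool"
  where "tensor_preserves_coequalizers M \<longleftrightarrow>
    (\<forall>X \<in> Obj M. \<forall>f g q. is_coequalizer M f g q \<longrightarrow>
      is_coequalizer M (Idt M X \<otimes>\<^bsub>M\<^esub> f) (Idt M X \<otimes>\<^bsub>M\<^esub> g) (Idt M X \<otimes>\<^bsub>M\<^esub> q) \<and>
      is_coequalizer M (f \<otimes>\<^bsub>M\<^esub> Idt M X) (g \<otimes>\<^bsub>M\<^esub> Idt M X) (q \<otimes>\<^bsub>M\<^esub> Idt M X))"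


section \<open>Hopf monoids\<close>

text \<open>
  \<open>Id \<otimes> \<sigma> \<otimes> Id : (W \<odot> X) \<odot> (Y \<odot> Z) \<rightarrow> (W \<odot> Y) \<odot> (X \<odot> Z)\<close>, with the associators written out.
\<close>

definition middle_braid :: "('o, 'm, 'x) braided_data_scheme \<Rightarrow> 'o \<Rightarrow> 'o \<Rightarrow> 'o \<Rightarrow> 'o \<Rightarrow> 'm"
  where "middle_braid M W X Y Z =
    inv_arrow M (Asc M W Y (X \<odot>\<^bsub>M\<^esub> Z))
    \<cdot>\<^bsub>M\<^esub> (Idt M W \<otimes>\<^bsub>M\<^esub> (Asc M Y X Z \<cdot>\<^bsub>M\<^esub> (Br M X Y \<otimes>\<^bsub>M\<^esub> Idt M Z) \<cdot>\<^bsub>M\<^esub> inv_arrow M (Asc M X Y Z)))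
    \<cdot>\<^bsub>M\<^esub> Asc M W X (Y \<odot>\<^bsub>M\<^esub> Z)"

record ('o, 'm) hopf_data =
  Car :: 'o
  mul :: 'm
  unt :: 'm
  cmul :: 'm
  cunt :: 'm
  antip :: 'm

definition monoid_object :: "('o, 'm, 'x) braided_data_scheme \<Rightarrow> 'o \<Rightarrow> 'm \<Rightarrow> 'm \<Rightarrow> bool"
  where "monoid_object M A m u \<longleftrightarrow>
    A \<in> Obj M \<and> m \<in> hom M (A \<odot>\<^bsub>M\<^esub> A) A \<and> u \<in> hom M \<one>\<^bsub>M\<^esub> A \<and>
    m \<cdot>\<^bsub>M\<^esub> (m \<otimes>\<^bsub>M\<^esub> Idt M A) = m \<cdot>\<^bsub>M\<^esub> (Idt M A \<otimes>\<^bsub>M\<^esub> m) \<cdot>\<^bsub>M\<^esub> Asc M A A A \<and>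
    m \<cdot>\<^bsub>M\<^esub> (u \<otimes>\<^bsub>M\<^esub> Idt M A) = Lu M A \<and>
    m \<cdot>\<^bsub>M\<^esub> (Idt M A \<otimes>\<^bsub>M\<^esub> u) = Ru M A"

definition comonoid_object :: "('o, 'm, 'x) braided_data_scheme \<Rightarrow> 'o \<Rightarrow> 'm \<Rightarrow> 'm \<Rightarrow> bool"
  where "comonoid_object M A d e \<longleftrightarrow>
    A \<in> Obj M \<and> d \<in> hom M A (A \<odot>\<^bsub>M\<^esub> A) \<and> e \<in> hom M A \<one>\<^bsub>M\<^esub> \<and>
    Asc M A A A \<cdot>\<^bsub>M\<^esub> (d \<otimes>\<^bsub>M\<^esub> Idt M A) \<cdot>\<^bsub>M\<^esub> d = (Idt M A \<otimes>\<^bsub>M\<^esub> d) \<cdot>\<^bsub>M\<^esub> d \<and>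
    Lu M A \<cdot>\<^bsub>M\<^esub> (e \<otimes>\<^bsub>M\<^esub> Idt M A) \<cdot>\<^bsub>M\<^esub> d = Idt M A \<and>
    Ru M A \<cdot>\<^bsub>M\<^esub> (Idt M A \<otimes>\<^bsub>M\<^esub> e) \<cdot>\<^bsub>M\<^esub> d = Idt M A"

definition bimonoid_object ::
    "('o, 'm, 'x) braided_data_scheme \<Rightarrow> 'o \<Rightarrow> 'm \<Rightarrow> 'm \<Rightarrow> 'm \<Rightarrow> 'm \<Rightarrow> bool"
  where "bimonoid_object M A m u d e \<longleftrightarrow>
    monoid_object M A m u \<and> comonoid_object M A d e \<and>
    d \<cdot>\<^bsub>M\<^esub> m = (m \<otimes>\<^bsub>M\<^esub> m) \<cdot>\<^bsub>M\<^esub> middle_braid M A A A A \<cdot>\<^bsub>M\<^esub> (d \<otimes>\<^bsub>M\<^esub> d) \<and>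
    d \<cdot>\<^bsub>M\<^esub> u = (u \<otimes>\<^bsub>M\<^esub> u) \<cdot>\<^bsub>M\<^esub> inv_arrow M (Lu M \<one>\<^bsub>M\<^esub>) \<and>
    e \<cdot>\<^bsub>M\<^esub> m = Lu M \<one>\<^bsub>M\<^esub> \<cdot>\<^bsub>M\<^esub> (e \<otimes>\<^bsub>M\<^esub> e) \<and>
    e \<cdot>\<^bsub>M\<^esub> u = Idt M \<one>\<^bsub>M\<^esub>"

definition hopf_monoid :: "('o, 'm, 'x) braided_data_scheme \<Rightarrow> ('o, 'm) hopf_data \<Rightarrow> bool"
  where "hopf_monoid M A \<longleftrightarrow>
    bimonoid_object M (Car A) (mul A) (unt A) (cmul A) (cunt A) \<and>
    antip A \<in> hom M (Car A) (Car A) \<and>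
    mul A \<cdot>\<^bsub>M\<^esub> (antip A \<otimes>\<^bsub>M\<^esub> Idt M (Car A)) \<cdot>\<^bsub>M\<^esub> cmul A = unt A \<cdot>\<^bsub>M\<^esub> cunt A \<and>
    mul A \<cdot>\<^bsub>M\<^esub> (Idt M (Car A) \<otimes>\<^bsub>M\<^esub> antip A) \<cdot>\<^bsub>M\<^esub> cmul A = unt A \<cdot>\<^bsub>M\<^esub> cunt A"

definition cocommutative :: "('o, 'm, 'x) braided_data_scheme \<Rightarrow> ('o, 'm) hopf_data \<Rightarrow> bool"
  where "cocommutative M A \<longleftrightarrow> Br M (Car A) (Car A) \<cdot>\<^bsub>M\<^esub> cmul A = cmul A"

text \<open>
  The last condition follows from the others, as a morphism of bimonoids between Hopf monoids
  preserves antipodes.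
\<close>

definition hopf_monoid_morphism ::
    "('o, 'm, 'x) braided_data_scheme \<Rightarrow> ('o, 'm) hopf_data \<Rightarrow> ('o, 'm) hopf_data \<Rightarrow> 'm \<Rightarrow> bool"
  where "hopf_monoid_morphism M A B f \<longleftrightarrow>
    f \<in> hom M (Car A) (Car B) \<and>
    f \<cdot>\<^bsub>M\<^esub> mul A = mul B \<cdot>\<^bsub>M\<^esub> (f \<otimes>\<^bsub>M\<^esub> f) \<and>
    f \<cdot>\<^bsub>M\<^esub> unt A = unt B \<and>
    cmul B \<cdot>\<^bsub>M\<^esub> f = (f \<otimes>\<^bsub>M\<^esub> f) \<cdot>\<^bsub>M\<^esub> cmul A \<and>
    cunt B \<cdot>\<^bsub>M\<^esub> f = cunt A \<and>
    f \<cdot>\<^bsub>M\<^esub> antip A = antip B \<cdot>\<^bsub>M\<^esub> f"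

text \<open>
  An arrow of \<open>Hopf M\<close> carries its source and target Hopf monoids, since the same arrow of \<open>M\<close> may
  underlie morphisms between different Hopf structures.
\<close>

record ('o, 'm) hopf_arrow =
  Src :: "('o, 'm) hopf_data"
  Und :: 'm
  Tgt :: "('o, 'm) hopf_data"

definition Hopf ::
    "('o, 'm, 'x) braided_data_scheme \<Rightarrow> (('o, 'm) hopf_data, ('o, 'm) hopf_arrow) category_data"
  where "Hopf M =
    \<lparr>Obj = {A. hopf_monoid M A},
     Arr = {h. hopf_monoid M (Src h) \<and> hopf_monoid M (Tgt h) \<and>
               hopf_monoid_morphism M (Src h) (Tgt h) (Und h)},
     Dom = Src,
     Cod = Tgt,
     Idt = (\<lambda>A. \<lparr>Src = A, Und = Idt M (Car A), Tgt = A\<rparr>),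
     Comp = (\<lambda>k h. \<lparr>Src = Src h, Und = Und k \<cdot>\<^bsub>M\<^esub> Und h, Tgt = Tgt k\<rparr>)\<rparr>"

definition Hopf_coc ::
    "('o, 'm, 'x) braided_data_scheme \<Rightarrow> (('o, 'm) hopf_data, ('o, 'm) hopf_arrow) category_data"
  where "Hopf_coc M = full_subcategory (Hopf M) (cocommutative M)"

definition phi ::
    "('o, 'm, 'x) braided_data_scheme \<Rightarrow> ('o, 'm) hopf_data \<Rightarrow> 'm \<Rightarrow> 'm"
  where "phi M B f =
    mul B \<cdot>\<^bsub>M\<^esub> (mul B \<otimes>\<^bsub>M\<^esub> Idt M (Car B)) \<cdot>\<^bsub>M\<^esub> ((Idt M (Car B) \<otimes>\<^bsub>M\<^esub> f) \<otimes>\<^bsub>M\<^esub> Idt M (Car B))"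

end

theory Submission
  imports Defs
begin

text \<open>
  Bimonoid structure: since \<open>\<phi>\<^sub>f\<close> and \<open>\<phi>\<^sub>g\<close> are compatible with multiplying by \<open>B\<close> on either side, and both
  are comultiplicative for the same comultiplication on \<open>B \<odot> A \<odot> B\<close>, the multiplication, comultiplication and
  counit of \<open>B\<close> descend along \<open>\<pi>\<close>; the axioms follow because all tensor powers of \<open>\<pi>\<close> are epic.

  The point that needs an argument is that \<open>\<pi> S\<close> coequalizes \<open>\<phi>\<^sub>f\<close> and \<open>\<phi>\<^sub>g\<close>. Let \<open>G : Q \<odot> B \<rightarrow> Q \<odot> B\<close> be the
  Galois map \<open>x \<otimes> b \<mapsto> x \<pi>(b\<^sub>1) \<otimes> b\<^sub>2\<close>, whose inverse is \<open>x \<otimes> b \<mapsto> x \<pi>(S b\<^sub>1) \<otimes> b\<^sub>2\<close>. The analogous map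
  on \<open>Q \<odot> (B \<odot> A \<odot> B)\<close> built from \<open>\<pi> \<phi>\<^sub>f = \<pi> \<phi>\<^sub>g\<close> intertwines with \<open>G\<close> through both \<open>Id \<otimes> \<phi>\<^sub>f\<close> and \<open>Id \<otimes> \<phi>\<^sub>g\<close>, and
  it is invertible, being composed of conjugates of the Galois maps of the three tensor factors.
  Therefore \<open>(Id \<otimes> \<pi>) G\<^sup>-\<^sup>1 (Id \<otimes> \<phi>\<^sub>f)\<close> and \<open>(Id \<otimes> \<pi>) G\<^sup>-\<^sup>1 (Id \<otimes> \<phi>\<^sub>g)\<close> agree, and applying the unit and
  the counit gives \<open>\<pi> S \<phi>\<^sub>f = \<pi> S \<phi>\<^sub>g\<close>.
\<close>

section \<open>Categories\<close>

context category
begin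

lemma homE:
  assumes "f \<in> hom C X Y"
  shows "f \<in> Arr C" "Dom C f = X" "Cod C f = Y" "X \<in> Obj C" "Y \<in> Obj C"
  using assms dom_obj cod_obj by (auto simp: hom_def)

lemma homI: "f \<in> Arr C \<Longrightarrow> Dom C f = X \<Longrightarrow> Cod C f = Y \<Longrightarrow> f \<in> hom C X Y"
  by (simp add: hom_def)

lemma idt_simps [simp]:
  assumes "X \<in> Obj C"
  shows "Idt C X \<in> Arr C" "Dom C (Idt C X) = X" "Cod C (Idt C X) = X"
  using idt_hom[OF assms] by (auto simp: hom_def)

lemma comp_simps [simp]:
  assumes "f \<in> Arr C" "g \<in> Arr C" "Cod C f = Dom C g"
  shows "g \<cdot> f \<in> Arr C" "Dom C (g \<cdot> f) = Dom C f" "Cod C (g \<cdot> f) = Cod C g"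
  using comp_hom[of f "Dom C f" "Cod C f" g "Cod C g"] assms by (auto simp: hom_def)

lemma obj_simps [simp]:
  assumes "f \<in> Arr C"
  shows "Dom C f \<in> Obj C" "Cod C f \<in> Obj C"
  using assms by (auto intro: dom_obj cod_obj)

lemma comp_idt' [simp]: "f \<in> Arr C \<Longrightarrow> Dom C f = X \<Longrightarrow> f \<cdot> Idt C X = f"
  using comp_idt by (auto simp: hom_def)

lemma idt_comp' [simp]: "f \<in> Arr C \<Longrightarrow> Cod C f = X \<Longrightarrow> Idt C X \<cdot> f = f"
  using idt_comp by (auto simp: hom_def)

lemma assoc [simp]:
  "f \<in> Arr C \<Longrightarrow> g \<in> Arr C \<Longrightarrow> h \<in> Arr C \<Longrightarrow> Cod C f = Dom C g \<Longrightarrow> Cod C g = Dom C h \<Longrightarrow>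
    (h \<cdot> g) \<cdot> f = h \<cdot> g \<cdot> f"
  using comp_assoc[of f "Dom C f" "Dom C g" g "Dom C h" h "Cod C h"] by (auto simp: hom_def)

text \<open>Since \<open>assoc\<close> makes every composite right-associated, an equation for
  \<open>a \<cdot> b\<close> no longer matches inside a longer chain; this variant carries the tail
  \<open>r\<close> along.\<close>

lemma comp_chain:
  assumes "a \<cdot> b = c" "a \<in> Arr C" "b \<in> Arr C" "Cod C b = Dom C a"
    and "r \<in> Arr C" "Cod C r = Dom C b"
  shows "a \<cdot> b \<cdot> r = c \<cdot> r"
  using assms assoc[of r b a] by simp

section \<open>Inverse arrows\<close>

lemma inverse_arrowsE:
  assumes "inverse_arrows C f g"
  shows "f \<in> Arr C" "g \<in> Arr C" "Dom C g = Cod C f" "Cod C g = Dom C f"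
    "g \<cdot> f = Idt C (Dom C f)" "f \<cdot> g = Idt C (Cod C f)"
  using assms by (auto simp: inverse_arrows_def hom_def)

lemma inverse_arrows_unique:
  assumes "inverse_arrows C f g" "inverse_arrows C f h"
  shows "g = h"
proof -
  note g = inverse_arrowsE[OF assms(1)] and h = inverse_arrowsE[OF assms(2)]
  have "g = g \<cdot> f \<cdot> h"
    using g h by simp
  also have "\<dots> = (g \<cdot> f) \<cdot> h"
    using g(1-4) h(1-4) inverse_arrowsE(1)[OF assms(1)] by simp
  also have "\<dots> = h"
    using g h by (simp del: assoc)
  finally show ?thesis .
qed

lemma inv_arrow: "iso_arrow C f \<Longrightarrow> inverse_arrows C f (inv_arrow C f)"
  unfolding iso_arrow_def inv_arrow_def
  by (rule theI') (auto intro: inverse_arrows_unique)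

lemma inv_arrow_simps:
  assumes "iso_arrow C f"
  shows "inv_arrow C f \<in> Arr C" "Dom C (inv_arrow C f) = Cod C f" "Cod C (inv_arrow C f) = Dom C f"
    "inv_arrow C f \<cdot> f = Idt C (Dom C f)" "f \<cdot> inv_arrow C f = Idt C (Cod C f)"
  using inverse_arrowsE[OF inv_arrow[OF assms]] by auto

lemma inv_arrow_cancel:
  assumes "iso_arrow C f" "r \<in> Arr C"
  shows "Cod C r = Dom C f \<Longrightarrow> inv_arrow C f \<cdot> f \<cdot> r = r"
    "Cod C r = Cod C f \<Longrightarrow> f \<cdot> inv_arrow C f \<cdot> r = r"
proof -
  have f: "f \<in> Arr C"
    using assms inv_arrow inverse_arrowsE by blast
  show "inv_arrow C f \<cdot> f \<cdot> r = r" if "Cod C r = Dom C f"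
    using comp_chain[OF inv_arrow_simps(4)[OF assms(1)], of r] that f assms
    by (simp add: inv_arrow_simps)
  show "f \<cdot> inv_arrow C f \<cdot> r = r" if "Cod C r = Cod C f"
    using comp_chain[OF inv_arrow_simps(5)[OF assms(1)], of r] that f assms
    by (simp add: inv_arrow_simps)
qed

lemma iso_arrowI:
  assumes "f \<in> hom C X Y" "g \<in> hom C Y X" "g \<cdot> f = Idt C X" "f \<cdot> g = Idt C Y"
  shows "iso_arrow C f"
  using assms by (auto simp: iso_arrow_def inverse_arrows_def hom_def)

lemma iso_arr: "iso_arrow C f \<Longrightarrow> f \<in> Arr C"
  by (auto simp: iso_arrow_def inverse_arrows_def)

lemma iso_comp:
  assumes "iso_arrow C f" "iso_arrow C g" "Cod C f = Dom C g"
  shows "iso_arrow C (g \<cdot> f)"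
  by (rule iso_arrowI[of _ "Dom C f" "Cod C g" "inv_arrow C f \<cdot> inv_arrow C g"])
    (use assms in \<open>simp_all add: homI iso_arr inv_arrow_simps inv_arrow_cancel\<close>)

lemma iso_inv: "iso_arrow C f \<Longrightarrow> iso_arrow C (inv_arrow C f)"
  by (rule iso_arrowI[of _ "Cod C f" "Dom C f" f]) (simp_all add: homI iso_arr inv_arrow_simps)

lemma iso_cancel_left:
  assumes "iso_arrow C f" "f \<cdot> x = f \<cdot> y" "x \<in> Arr C" "y \<in> Arr C"
    "Cod C x = Dom C f" "Cod C y = Dom C f"
  shows "x = y"
proof -
  have "inv_arrow C f \<cdot> f \<cdot> x = inv_arrow C f \<cdot> f \<cdot> y"
    by (simp only: assms(2))
  then show ?thesis
    using inv_arrow_cancel(1)[OF assms(1)] assms(3-6) by (simp only:)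
qed

lemma iso_cancel_right:
  assumes iso: "iso_arrow C f" and eq: "x \<cdot> f = y \<cdot> f" and "x \<in> Arr C" "y \<in> Arr C"
    "Dom C x = Cod C f" "Dom C y = Cod C f"
  shows "x = y"
proof -
  have "(x \<cdot> f) \<cdot> inv_arrow C f = (y \<cdot> f) \<cdot> inv_arrow C f"
    by (simp only: eq)
  then show ?thesis
    using assms(1,3-6) by (simp add: iso_arr inv_arrow_simps)
qed

section \<open>Epimorphisms and coequalizers\<close>

definition epi :: "'m \<Rightarrow> bool"
  where "epi q \<longleftrightarrow> q \<in> Arr C \<and> (\<forall>h \<in> Arr C. \<forall>k \<in> Arr C.
    Dom C h = Cod C q \<and> Dom C k = Cod C q \<and> h \<cdot> q = k \<cdot> q \<longrightarrow> h = k)"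

lemma epiD:
  "epi q \<Longrightarrow> h \<cdot> q = k \<cdot> q \<Longrightarrow> h \<in> Arr C \<Longrightarrow> k \<in> Arr C \<Longrightarrow> Dom C h = Cod C q \<Longrightarrow> Dom C k = Cod C q \<Longrightarrow> h = k"
  by (auto simp: epi_def)

lemma epi_arr: "epi q \<Longrightarrow> q \<in> Arr C"
  by (simp add: epi_def)

lemma epi_comp:
  assumes "epi p" "epi q" "Cod C p = Dom C q"
  shows "epi (q \<cdot> p)"
proof -
  have "h = k" if "h \<in> Arr C" "k \<in> Arr C" "Dom C h = Cod C q" "Dom C k = Cod C q"
    "h \<cdot> q \<cdot> p = k \<cdot> q \<cdot> p" for h k
  proof -
    have "(h \<cdot> q) \<cdot> p = (k \<cdot> q) \<cdot> p"
      using that assms by (simp add: epi_arr)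
    then have "h \<cdot> q = k \<cdot> q"
      by (rule epiD[OF assms(1)]) (use that(1-4) assms in \<open>simp_all add: epi_arr\<close>)
    then show ?thesis
      by (rule epiD[OF assms(2)]) (use that(1-4) in simp_all)
  qed
  then show ?thesis
    using assms by (simp add: epi_def)
qed

lemma coequalizer_simps:
  assumes "is_coequalizer C f g q"
  shows "f \<in> Arr C" "g \<in> Arr C" "q \<in> Arr C" "Dom C g = Dom C f" "Cod C g = Cod C f"
    "Dom C q = Cod C f" "q \<cdot> f = q \<cdot> g"
  using assms by (auto simp: is_coequalizer_def parallel_def)

lemma coequalizer_factor:
  assumes "is_coequalizer C f g q" "h \<in> Arr C" "Dom C h = Cod C f" "h \<cdot> f = h \<cdot> g"
  shows "\<exists>!k. k \<in> hom C (Cod C q) (Cod C h) \<and> k \<cdot> q = h"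
  using assms unfolding is_coequalizer_def by blast

text \<open>The arrow \<open>h \<cdot> q\<close> coequalizes the pair and factors through
  \<open>q\<close> by both \<open>h\<close> and \<open>k\<close>; uniqueness of the factorization
  identifies them.\<close>

lemma coequalizer_epi:
  assumes "is_coequalizer C f g q"
  shows "epi q"
  unfolding epi_def
proof (intro conjI ballI impI)
  show q: "q \<in> Arr C"
    using assms by (rule coequalizer_simps)
  fix h k assume hk: "h \<in> Arr C" "k \<in> Arr C"
    and "Dom C h = Cod C q \<and> Dom C k = Cod C q \<and> h \<cdot> q = k \<cdot> q"
  then have d: "Dom C h = Cod C q" "Dom C k = Cod C q" and eq: "h \<cdot> q = k \<cdot> q"
    by auto
  note s = coequalizer_simps[OF assms]
  have "h \<cdot> q \<in> Arr C" "Dom C (h \<cdot> q) = Cod C f" "Cod C (h \<cdot> q) = Cod C h"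
    using s hk d by simp_all
  moreover have "(h \<cdot> q) \<cdot> f = (h \<cdot> q) \<cdot> g"
    using s hk d by simp
  ultimately have "\<exists>!l. l \<in> hom C (Cod C q) (Cod C h) \<and> l \<cdot> q = h \<cdot> q"
    using coequalizer_factor[OF assms, of "h \<cdot> q"] by simp
  \<comment> \<open>Uniqueness ranges over arrows into \<open>Cod C h\<close>, so \<open>k\<close>
    must first be seen to be one of them.\<close>
  moreover have "Cod C h = Cod C k"
    using eq hk d s by (metis comp_simps(3))
  ultimately show "h = k"
    using hk d eq by (metis homI)
qed

end

section \<open>Monoidal categories\<close>

context monoidal_category
begin

abbreviation Asc' :: "'o \<Rightarrow> 'o \<Rightarrow> 'o \<Rightarrow> 'm"
  where "Asc' X Y Z \<equiv> inv_arrow M (Asc M X Y Z)"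

lemma unit_obj' [simp]: "\<one> \<in> Obj M"
  by (rule unit_obj)

lemma tens_obj' [simp]: "X \<in> Obj M \<Longrightarrow> Y \<in> Obj M \<Longrightarrow> X \<odot> Y \<in> Obj M"
  by (rule tens_obj)

lemma tens_simps [simp]:
  assumes "f \<in> Arr M" "g \<in> Arr M"
  shows "f \<otimes> g \<in> Arr M" "Dom M (f \<otimes> g) = Dom M f \<odot> Dom M g" "Cod M (f \<otimes> g) = Cod M f \<odot> Cod M g"
  using tens_hom[of f "Dom M f" "Cod M f" g "Dom M g" "Cod M g"] assms by (auto simp: hom_def)

lemma tens_idt' [simp]: "X \<in> Obj M \<Longrightarrow> Y \<in> Obj M \<Longrightarrow> Idt M X \<otimes> Idt M Y = Idt M (X \<odot> Y)"
  by (rule tens_idt)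

text \<open>Oriented to merge composites factorwise. Together with \<open>assoc\<close> this gives
  the normal form on which \<open>simp\<close> compares two sides; a naturality square often has to
  be bracketed out by hand before \<open>subst\<close> can find it, as in many calculations
  below.\<close>

lemma interchange [simp]:
  assumes "f \<in> Arr M" "f' \<in> Arr M" "g \<in> Arr M" "g' \<in> Arr M" "Cod M f = Dom M f'" "Cod M g =
    Dom M g'"
  shows "(f' \<otimes> g') \<cdot> (f \<otimes> g) = (f' \<cdot> f) \<otimes> (g' \<cdot> g)"
  using tens_comp[of f "Dom M f" "Dom M f'" f' "Cod M f'" g "Dom M g" "Dom M g'" g' "Cod M g'"] assms
  by (auto simp: hom_def)

lemma interchange_chain [simp]:
  assumes "f \<in> Arr M" "f' \<in> Arr M" "g \<in> Arr M" "g' \<in> Arr M" "Cod M f = Dom M f'" "Cod M g =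
    Dom M g'"
    "r \<in> Arr M" "Cod M r = Dom M f \<odot> Dom M g"
  shows "(f' \<otimes> g') \<cdot> (f \<otimes> g) \<cdot> r = ((f' \<cdot> f) \<otimes> (g' \<cdot> g)) \<cdot> r"
  by (rule comp_chain) (use assms in simp_all)

lemma asc_simps [simp]:
  assumes "X \<in> Obj M" "Y \<in> Obj M" "Z \<in> Obj M"
  shows "Asc M X Y Z \<in> Arr M" "Dom M (Asc M X Y Z) = (X \<odot> Y) \<odot> Z" "Cod M (Asc M X Y Z) =
    X \<odot> (Y \<odot> Z)"
    "iso_arrow M (Asc M X Y Z)"
  using asc_hom[OF assms] asc_iso[OF assms] by (auto simp: hom_def)

lemma lu_simps [simp]:
  assumes "X \<in> Obj M"
  shows "Lu M X \<in> Arr M" "Dom M (Lu M X) = \<one> \<odot> X" "Cod M (Lu M X) = X" "iso_arrow M (Lu M X)"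
  using lu_hom[OF assms] lu_iso[OF assms] by (auto simp: hom_def)

lemma ru_simps [simp]:
  assumes "X \<in> Obj M"
  shows "Ru M X \<in> Arr M" "Dom M (Ru M X) = X \<odot> \<one>" "Cod M (Ru M X) = X" "iso_arrow M (Ru M X)"
  using ru_hom[OF assms] ru_iso[OF assms] by (auto simp: hom_def)

lemmas inv_simps [simp] = inv_arrow_simps inv_arrow_cancel

lemma asc_nat:
  assumes "f \<in> Arr M" "g \<in> Arr M" "h \<in> Arr M" "Cod M f = X" "Cod M g = Y" "Cod M h = Z"
  shows "Asc M X Y Z \<cdot> ((f \<otimes> g) \<otimes> h) = (f \<otimes> (g \<otimes> h)) \<cdot> Asc M (Dom M f) (Dom M g) (Dom M h)"
  using asc_natural[of f "Dom M f" X g "Dom M g" Y h "Dom M h" Z] assms by (auto simp: hom_def)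

text \<open>Composing the given square with \<open>inv_arrow M a\<close> on the left and
  \<open>inv_arrow M b\<close> on the right inverts its two invertible sides. This transfers
  naturality to inverse constraints.\<close>

lemma inv_nat:
  assumes "iso_arrow M a" "iso_arrow M b" "a \<cdot> x = y \<cdot> b" "x \<in> Arr M" "y \<in> Arr M"
    "Cod M x = Dom M a" "Dom M x = Dom M b" "Dom M y = Cod M b" "Cod M y = Cod M a"
  shows "inv_arrow M a \<cdot> y = x \<cdot> inv_arrow M b"
proof -
  have "inv_arrow M a \<cdot> (a \<cdot> x) \<cdot> inv_arrow M b = inv_arrow M a \<cdot> (y \<cdot> b) \<cdot> inv_arrow M b"
    by (simp only: assms(3))
  then show ?thesis
    using assms(1,2,4-) by (simp add: iso_arr)
qed

lemma asc'_nat: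
  assumes "f \<in> Arr M" "g \<in> Arr M" "h \<in> Arr M" "Cod M f = X" "Cod M g = Y" "Cod M h = Z"
  shows "Asc' X Y Z \<cdot> (f \<otimes> (g \<otimes> h)) = ((f \<otimes> g) \<otimes> h) \<cdot> Asc' (Dom M f) (Dom M g) (Dom M h)"
  using assms by (intro inv_nat[OF _ _ asc_nat]) auto

lemma lu_nat: "f \<in> Arr M \<Longrightarrow> Cod M f = Y \<Longrightarrow> Lu M Y \<cdot> (Idt M \<one> \<otimes> f) = f \<cdot> Lu M (Dom M f)"
  using lu_natural[of f "Dom M f" Y] by (auto simp: hom_def)

lemma ru_nat: "f \<in> Arr M \<Longrightarrow> Cod M f = Y \<Longrightarrow> Ru M Y \<cdot> (f \<otimes> Idt M \<one>) = f \<cdot> Ru M (Dom M f)"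
  using ru_natural[of f "Dom M f" Y] by (auto simp: hom_def)

lemma iso_tens:
  assumes "iso_arrow M f" "iso_arrow M g"
  shows "iso_arrow M (f \<otimes> g)"
  by (rule iso_arrowI[of _ "Dom M f \<odot> Dom M g" "Cod M f \<odot> Cod M g" "inv_arrow M f \<otimes> inv_arrow M g"])
    (use assms in \<open>auto simp: iso_arr intro!: homI\<close>)

lemma iso_idt: "X \<in> Obj M \<Longrightarrow> iso_arrow M (Idt M X)"
  by (rule iso_arrowI[of _ X X "Idt M X"]) (auto intro: homI)

text \<open>This and the next three lemmas are the pentagon with some associators moved across as
  inverses, in the shapes in which it occurs later; each comes from composing with inverses and
  cancelling.\<close>

lemma pentagon_inv1:
  assumes "W \<in> Obj M" "X \<in> Obj M" "Y \<in> Obj M" "Z \<in> Obj M"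
  shows "(Asc M W X Y \<otimes> Idt M Z) \<cdot> Asc' (W \<odot> X) Y Z =
    Asc' W (X \<odot> Y) Z \<cdot> (Idt M W \<otimes> Asc' X Y Z) \<cdot> Asc M W X (Y \<odot> Z)"
proof -
  have "Asc' W (X \<odot> Y) Z \<cdot> (Idt M W \<otimes> Asc' X Y Z) \<cdot> (Asc M W X (Y \<odot> Z) \<cdot> Asc M (W \<odot> X) Y Z) \<cdot>
      Asc' (W \<odot> X) Y Z =
    Asc' W (X \<odot> Y) Z \<cdot> (Idt M W \<otimes> Asc' X Y Z) \<cdot>
      ((Idt M W \<otimes> Asc M X Y Z) \<cdot> Asc M W (X \<odot> Y) Z \<cdot> (Asc M W X Y \<otimes> Idt M Z)) \<cdot> Asc' (W \<odot> X) Y Z"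
    by (simp only: pentagon[OF assms])
  then show ?thesis
    using assms by simp
qed

lemma pentagon_inv2:
  assumes "W \<in> Obj M" "X \<in> Obj M" "Y \<in> Obj M" "Z \<in> Obj M"
  shows "Asc M (W \<odot> X) Y Z \<cdot> (Asc' W X Y \<otimes> Idt M Z) \<cdot> Asc' W (X \<odot> Y) Z =
    Asc' W X (Y \<odot> Z) \<cdot> (Idt M W \<otimes> Asc M X Y Z)"
proof -
  have "Asc' W X (Y \<odot> Z) \<cdot> (Asc M W X (Y \<odot> Z) \<cdot> Asc M (W \<odot> X) Y Z) \<cdot>
      (Asc' W X Y \<otimes> Idt M Z) \<cdot> Asc' W (X \<odot> Y) Z =
    Asc' W X (Y \<odot> Z) \<cdot>
      ((Idt M W \<otimes> Asc M X Y Z) \<cdot> Asc M W (X \<odot> Y) Z \<cdot> (Asc M W X Y \<otimes> Idt M Z)) \<cdot>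
      (Asc' W X Y \<otimes> Idt M Z) \<cdot> Asc' W (X \<odot> Y) Z"
    by (simp only: pentagon[OF assms])
  then show ?thesis
    using assms by simp
qed

lemma pentagon_inv3:
  assumes "W \<in> Obj M" "X \<in> Obj M" "Y \<in> Obj M" "Z \<in> Obj M"
  shows "(Asc' W X Y \<otimes> Idt M Z) \<cdot> Asc' W (X \<odot> Y) Z \<cdot> (Idt M W \<otimes> Asc' X Y Z) =
    Asc' (W \<odot> X) Y Z \<cdot> Asc' W X (Y \<odot> Z)"
proof -
  have "Asc' (W \<odot> X) Y Z \<cdot> (Asc M (W \<odot> X) Y Z \<cdot> (Asc' W X Y \<otimes> Idt M Z) \<cdot> Asc' W (X \<odot> Y) Z) \<cdot>
      (Idt M W \<otimes> Asc' X Y Z) =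
    Asc' (W \<odot> X) Y Z \<cdot> (Asc' W X (Y \<odot> Z) \<cdot> (Idt M W \<otimes> Asc M X Y Z)) \<cdot> (Idt M W \<otimes> Asc' X Y Z)"
    by (simp only: pentagon_inv2[OF assms])
  then show ?thesis
    using assms by simp
qed

lemma pentagon_inv4:
  assumes "W \<in> Obj M" "X \<in> Obj M" "Y \<in> Obj M" "Z \<in> Obj M"
  shows "(Asc M W X Y \<otimes> Idt M Z) \<cdot> Asc' (W \<odot> X) Y Z \<cdot> Asc' W X (Y \<odot> Z) =
    Asc' W (X \<odot> Y) Z \<cdot> (Idt M W \<otimes> Asc' X Y Z)"
  using comp_chain[OF pentagon_inv1[OF assms], of "Asc' W X (Y \<odot> Z)"] assms by simp

lemma triangle_inv:
  assumes "X \<in> Obj M" "Y \<in> Obj M"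
  shows "(Ru M X \<otimes> Idt M Y) \<cdot> Asc' X \<one> Y = Idt M X \<otimes> Lu M Y"
proof -
  have "((Idt M X \<otimes> Lu M Y) \<cdot> Asc M X \<one> Y) \<cdot> Asc' X \<one> Y = (Ru M X \<otimes> Idt M Y) \<cdot> Asc' X \<one> Y"
    by (simp only: triangle[OF assms])
  then show ?thesis
    using assms by simp
qed

subsection \<open>Galois maps\<close>

text \<open>
  In generalised elements \<open>galois Q m C \<delta>\<close> is \<open>x \<otimes> y \<mapsto> x y\<^sub>0 \<otimes> y\<^sub>1\<close>, where \<open>\<delta> y = y\<^sub>0 \<otimes> y\<^sub>1\<close>.
  For \<open>\<delta> = (c \<otimes> Id) \<cdot> \<Delta>\<close> it turns convolution of the arrows \<open>c\<close> into composition in reverse order,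
  and it can be inverted on tensor products of comonoids without proving these coassociative.
\<close>

definition galois :: "'o \<Rightarrow> 'm \<Rightarrow> 'o \<Rightarrow> 'm \<Rightarrow> 'm"
  where "galois Q m C \<delta> = (m \<otimes> Idt M C) \<cdot> Asc' Q Q C \<cdot> (Idt M Q \<otimes> \<delta>)"

lemma galois_simps [simp]:
  assumes "m \<in> hom M (Q \<odot> Q) Q" "\<delta> \<in> hom M C (Q \<odot> C)"
  shows "galois Q m C \<delta> \<in> Arr M" "Dom M (galois Q m C \<delta>) = Q \<odot> C" "Cod M (galois Q m C \<delta>) = Q \<odot> C"
  using homE[OF assms(1)] homE[OF assms(2)] by (simp_all add: galois_def)

text \<open>For \<delta> and \<delta>' obtained from comultiplications and arrows to
  \<open>Q\<close>, the last hypothesis holds when \<open>h\<close> is comultiplicative and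
  compatible with those arrows. Naturality of the inverse associator does the rest.\<close>

lemma galois_natural:
  assumes "m \<in> hom M (Q \<odot> Q) Q" "\<delta> \<in> hom M C (Q \<odot> C)" "\<delta>' \<in> hom M D (Q \<odot> D)" "h \<in> hom M C D"
    and "\<delta>' \<cdot> h = (Idt M Q \<otimes> h) \<cdot> \<delta>"
  shows "galois Q m D \<delta>' \<cdot> (Idt M Q \<otimes> h) = (Idt M Q \<otimes> h) \<cdot> galois Q m C \<delta>"
proof -
  note [simp] = homE[OF assms(1)] homE[OF assms(2)] homE[OF assms(3)] homE[OF assms(4)]
  have "galois Q m D \<delta>' \<cdot> (Idt M Q \<otimes> h) = (m \<otimes> Idt M D) \<cdot> Asc' Q Q D \<cdot> (Idt M Q \<otimes> (\<delta>' \<cdot> h))"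
    by (simp add: galois_def)
  also have "\<dots> = (m \<otimes> Idt M D) \<cdot> (Asc' Q Q D \<cdot> (Idt M Q \<otimes> (Idt M Q \<otimes> h))) \<cdot> (Idt M Q \<otimes> \<delta>)"
    by (simp add: assms(5))
  also have "\<dots> = (m \<otimes> Idt M D) \<cdot> (((Idt M Q \<otimes> Idt M Q) \<otimes> h) \<cdot> Asc' Q Q C) \<cdot> (Idt M Q \<otimes> \<delta>)"
    by (subst asc'_nat) simp_all
  also have "\<dots> = (Idt M Q \<otimes> h) \<cdot> galois Q m C \<delta>"
    by (simp add: galois_def)
  finally show ?thesis .
qed

text \<open>\<open>galois Q m C \<delta>\<close> is the left \<open>Q\<close>-linear extension of
  \<delta> to the free module \<open>Q \<odot> C\<close>. A composite of two such extensions is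
  again one, namely that of \<open>galois Q m C \<delta> \<cdot> \<delta>'\<close>, which is the
  argument on the right.\<close>

lemma galois_comp:
  assumes m: "m \<in> hom M (Q \<odot> Q) Q" "\<delta> \<in> hom M C (Q \<odot> C)" "\<delta>' \<in> hom M C (Q \<odot> C)"
    and ass: "m \<cdot> (m \<otimes> Idt M Q) = m \<cdot> (Idt M Q \<otimes> m) \<cdot> Asc M Q Q Q"
  shows "galois Q m C \<delta> \<cdot> galois Q m C \<delta>' = galois Q m C ((m \<otimes> Idt M C) \<cdot> Asc' Q Q C \<cdot>
    (Idt M Q \<otimes> \<delta>) \<cdot> \<delta>')"
proof -
  note [simp] = homE[OF assms(1)] homE[OF assms(2)] homE[OF assms(3)]
  let ?Q = "Idt M Q"
  let ?C = "Idt M C"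
  have "galois Q m C \<delta> \<cdot> galois Q m C \<delta>' =
    (m \<otimes> ?C) \<cdot> (Asc' Q Q C \<cdot> (m \<otimes> (?Q \<otimes> ?C))) \<cdot> (((?Q \<otimes> ?Q) \<otimes> \<delta>) \<cdot> Asc' Q Q C) \<cdot> (?Q \<otimes> \<delta>')"
    by (simp add: galois_def)
  also have "\<dots> = (m \<otimes> ?C) \<cdot> (((m \<otimes> ?Q) \<otimes> ?C) \<cdot> Asc' (Q \<odot> Q) Q C) \<cdot> (Asc' Q Q (Q \<odot> C) \<cdot>
    (?Q \<otimes> (?Q \<otimes> \<delta>))) \<cdot> (?Q \<otimes> \<delta>')"
    by (subst (1 2) asc'_nat) simp_all
  also have "\<dots> = ((m \<cdot> (m \<otimes> ?Q)) \<otimes> ?C) \<cdot> Asc' (Q \<odot> Q) Q C \<cdot> Asc' Q Q (Q \<odot> C) \<cdot>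
    (?Q \<otimes> ((?Q \<otimes> \<delta>) \<cdot> \<delta>'))"
    by simp
  also have "\<dots> = ((m \<cdot> (?Q \<otimes> m) \<cdot> Asc M Q Q Q) \<otimes> ?C) \<cdot> Asc' (Q \<odot> Q) Q C \<cdot> Asc' Q Q (Q \<odot> C) \<cdot>
    (?Q \<otimes> ((?Q \<otimes> \<delta>) \<cdot> \<delta>'))"
    by (simp only: ass)
  \<comment> \<open>Associativity of \<open>m\<close> has left an associator behind; the pentagon
    absorbs it together with the two inverse ones.\<close>
  also have "\<dots> = (m \<otimes> ?C) \<cdot> ((?Q \<otimes> m) \<otimes> ?C) \<cdot> ((Asc M Q Q Q \<otimes> ?C) \<cdot> Asc' (Q \<odot> Q) Q C \<cdot>
    Asc' Q Q (Q \<odot> C)) \<cdot> (?Q \<otimes> ((?Q \<otimes> \<delta>) \<cdot> \<delta>'))"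
    by simp
  also have "\<dots> = (m \<otimes> ?C) \<cdot> (((?Q \<otimes> m) \<otimes> ?C) \<cdot> Asc' Q (Q \<odot> Q) C) \<cdot>
    (?Q \<otimes> (Asc' Q Q C \<cdot> (?Q \<otimes> \<delta>) \<cdot> \<delta>'))"
    by (subst pentagon_inv4) simp_all
  also have "\<dots> = (m \<otimes> ?C) \<cdot> (Asc' Q Q C \<cdot> (?Q \<otimes> (m \<otimes> ?C))) \<cdot> (?Q \<otimes> (Asc' Q Q C \<cdot> (?Q \<otimes> \<delta>) \<cdot> \<delta>'))"
    by (subst asc'_nat) simp_all
  also have "\<dots> = galois Q m C ((m \<otimes> ?C) \<cdot> Asc' Q Q C \<cdot> (?Q \<otimes> \<delta>) \<cdot> \<delta>')"
    by (simp add: galois_def)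
  finally show ?thesis .
qed

text \<open>In generalised elements x \<otimes> y goes to x c'(y1) \<otimes> y2 and then to x c'(y1)
  c(y2) \<otimes> y3, by coassociativity of \<open>d\<close>. This is why \<open>c'\<close> comes
  first in the product.\<close>

lemma galois_convolution:
  assumes Q: "monoid_object M Q m u" and C: "comonoid_object M C d e"
    and c: "c \<in> hom M C Q" "c' \<in> hom M C Q"
  shows "galois Q m C ((c \<otimes> Idt M C) \<cdot> d) \<cdot> galois Q m C ((c' \<otimes> Idt M C) \<cdot> d) =
    galois Q m C (((m \<cdot> (c' \<otimes> c) \<cdot> d) \<otimes> Idt M C) \<cdot> d)"
proof -
  have m: "m \<in> hom M (Q \<odot> Q) Q" and d: "d \<in> hom M C (C \<odot> C)"
    and ass: "m \<cdot> (m \<otimes> Idt M Q) = m \<cdot> (Idt M Q \<otimes> m) \<cdot> Asc M Q Q Q"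
    and coass: "Asc M C C C \<cdot> (d \<otimes> Idt M C) \<cdot> d = (Idt M C \<otimes> d) \<cdot> d"
    using Q C by (auto simp: monoid_object_def comonoid_object_def)
  note [simp] = homE[OF m] homE[OF d] homE[OF c(1)] homE[OF c(2)]
  let ?C = "Idt M C"
  have "(m \<otimes> ?C) \<cdot> Asc' Q Q C \<cdot> (Idt M Q \<otimes> ((c \<otimes> ?C) \<cdot> d)) \<cdot> (c' \<otimes> ?C) \<cdot> d =
    (m \<otimes> ?C) \<cdot> (Asc' Q Q C \<cdot> (c' \<otimes> (c \<otimes> ?C))) \<cdot> (?C \<otimes> d) \<cdot> d"
    by simp
  also have "\<dots> = (m \<otimes> ?C) \<cdot> (((c' \<otimes> c) \<otimes> ?C) \<cdot> Asc' C C C) \<cdot> (?C \<otimes> d) \<cdot> d"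
    by (subst asc'_nat) simp_all
  also have "\<dots> = (m \<otimes> ?C) \<cdot> (((c' \<otimes> c) \<otimes> ?C) \<cdot> Asc' C C C) \<cdot> Asc M C C C \<cdot> (d \<otimes> Idt M C) \<cdot> d"
    by (simp only: coass)
  also have "\<dots> = ((m \<cdot> (c' \<otimes> c) \<cdot> d) \<otimes> ?C) \<cdot> d"
    by simp
  finally show ?thesis
    by (subst galois_comp[OF m _ _ ass]) (simp_all add: homI)
qed

text \<open>The counit removes the factor split off by \<open>d\<close>, the unit law of
  \<open>Q\<close> removes the product, and the triangle identity matches the two unit
  constraints.\<close>

lemma galois_unit:
  assumes Q: "monoid_object M Q m u" and C: "comonoid_object M C d e"
  shows "galois Q m C (((u \<cdot> e) \<otimes> Idt M C) \<cdot> d) = Idt M (Q \<odot> C)"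
proof -
  have m: "m \<in> hom M (Q \<odot> Q) Q" and d: "d \<in> hom M C (C \<odot> C)" and u: "u \<in> hom M \<one> Q"
    and e: "e \<in> hom M C \<one>" and un: "m \<cdot> (Idt M Q \<otimes> u) = Ru M Q"
    and coun: "Lu M C \<cdot> (e \<otimes> Idt M C) \<cdot> d = Idt M C"
    using Q C by (auto simp: monoid_object_def comonoid_object_def)
  note [simp] = homE[OF m] homE[OF d] homE[OF u] homE[OF e]
  let ?C = "Idt M C"
  let ?Q = "Idt M Q"
  have "galois Q m C (((u \<cdot> e) \<otimes> ?C) \<cdot> d) =
    (m \<otimes> ?C) \<cdot> (Asc' Q Q C \<cdot> (?Q \<otimes> (u \<otimes> ?C))) \<cdot> (?Q \<otimes> ((e \<otimes> ?C) \<cdot> d))"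
    by (simp add: galois_def)
  also have "\<dots> = (m \<otimes> ?C) \<cdot> (((?Q \<otimes> u) \<otimes> ?C) \<cdot> Asc' Q \<one> C) \<cdot> (?Q \<otimes> ((e \<otimes> ?C) \<cdot> d))"
    by (subst asc'_nat) simp_all
  also have "\<dots> = ((Ru M Q \<otimes> ?C) \<cdot> Asc' Q \<one> C) \<cdot> (?Q \<otimes> ((e \<otimes> ?C) \<cdot> d))"
    by (simp add: un)
  also have "\<dots> = Idt M (Q \<odot> C)"
    by (simp add: triangle_inv coun)
  finally show ?thesis .
qed

text \<open>Composing in either order gives the Galois map of a convolution product of
  \<open>c\<close> and \<open>c'\<close>, hence of the convolution unit \<open>u \<cdot> e\<close>,
  which is the identity.\<close>

lemma galois_iso:
  assumes Q: "monoid_object M Q m u" and C: "comonoid_object M C d e"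
    and c: "c \<in> hom M C Q" "c' \<in> hom M C Q"
    and inv: "m \<cdot> (c \<otimes> c') \<cdot> d = u \<cdot> e" "m \<cdot> (c' \<otimes> c) \<cdot> d = u \<cdot> e"
  shows "inverse_arrows M (galois Q m C ((c \<otimes> Idt M C) \<cdot> d)) (galois Q m C ((c' \<otimes> Idt M C) \<cdot> d))"
proof -
  have m: "m \<in> hom M (Q \<odot> Q) Q" and d: "d \<in> hom M C (C \<odot> C)"
    using Q C by (auto simp: monoid_object_def comonoid_object_def)
  note [simp] = homE[OF m] homE[OF d] homE[OF c(1)] homE[OF c(2)]
  have *: "(c \<otimes> Idt M C) \<cdot> d \<in> hom M C (Q \<odot> C)" "(c' \<otimes> Idt M C) \<cdot> d \<in> hom M C (Q \<odot> C)"
    by (simp_all add: homI)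
  show ?thesis
    unfolding inverse_arrows_def
    using galois_convolution[OF Q C c] galois_convolution[OF Q C c(2,1)] galois_unit[OF Q C] inv m *
    by (simp add: homI)
qed

end

section \<open>Braidings\<close>

context braided_monoidal_category
begin

lemma br_simps [simp]:
  assumes "X \<in> Obj M" "Y \<in> Obj M"
  shows "Br M X Y \<in> Arr M" "Dom M (Br M X Y) = X \<odot> Y" "Cod M (Br M X Y) = Y \<odot> X"
    "iso_arrow M (Br M X Y)"
  using br_hom[OF assms] br_iso[OF assms] by (auto simp: hom_def)

lemma br_nat: "f \<in> Arr M \<Longrightarrow> g \<in> Arr M \<Longrightarrow> Cod M f = X \<Longrightarrow> Cod M g = Y \<Longrightarrow>
    Br M X Y \<cdot> (f \<otimes> g) = (g \<otimes> f) \<cdot> Br M (Dom M f) (Dom M g)"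
  using br_natural[of f "Dom M f" X g "Dom M g" Y] by (auto simp: hom_def)

text \<open>Isolates from \<open>middle_braid\<close> the part under \<open>Idt M W\<close>, so that
  naturality and the hexagon can be stated for it with all objects bracketed to the right.\<close>

definition br_left :: "'a \<Rightarrow> 'a \<Rightarrow> 'a \<Rightarrow> 'b"
  where "br_left X Y Z = Asc M Y X Z \<cdot> (Br M X Y \<otimes> Idt M Z) \<cdot> Asc' X Y Z"

lemma br_left_simps [simp]:
  assumes "X \<in> Obj M" "Y \<in> Obj M" "Z \<in> Obj M"
  shows "br_left X Y Z \<in> Arr M" "Dom M (br_left X Y Z) = X \<odot> (Y \<odot> Z)"
    "Cod M (br_left X Y Z) = Y \<odot> (X \<odot> Z)" "iso_arrow M (br_left X Y Z)"
  unfolding br_left_def using assms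
  by (simp_all add: iso_comp iso_tens iso_idt iso_inv)

lemma br_left_nat:
  assumes "f \<in> Arr M" "g \<in> Arr M" "h \<in> Arr M" "Cod M f = X" "Cod M g = Y" "Cod M h = Z"
  shows "br_left X Y Z \<cdot> (f \<otimes> (g \<otimes> h)) = (g \<otimes> (f \<otimes> h)) \<cdot> br_left (Dom M f) (Dom M g) (Dom M h)"
proof -
  have [simp]: "X \<in> Obj M" "Y \<in> Obj M" "Z \<in> Obj M"
    using assms by auto
  note [simp] = assms
  have "br_left X Y Z \<cdot> (f \<otimes> (g \<otimes> h)) =
    Asc M Y X Z \<cdot> ((Br M X Y \<cdot> (f \<otimes> g)) \<otimes> h) \<cdot> Asc' (Dom M f) (Dom M g) (Dom M h)"
    by (simp add: br_left_def asc'_nat)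
  also have "\<dots> = (Asc M Y X Z \<cdot> ((g \<otimes> f) \<otimes> h)) \<cdot> (Br M (Dom M f) (Dom M g) \<otimes> Idt M (Dom M h)) \<cdot>
      Asc' (Dom M f) (Dom M g) (Dom M h)"
    by (simp add: br_nat)
  also have "\<dots> = (g \<otimes> (f \<otimes> h)) \<cdot> br_left (Dom M f) (Dom M g) (Dom M h)"
    by (subst asc_nat) (simp_all add: br_left_def)
  finally show ?thesis .
qed

text \<open>This is \<open>hexagon1\<close> tensored with \<open>D\<close>: the work lies in moving
  \<open>D\<close> through the brackets, by three forms of the pentagon and naturality of the
  inverse associator.\<close>

lemma br_left_hexagon:
  assumes [simp]: "C \<in> Obj M" "D \<in> Obj M" "Q \<in> Obj M" "R \<in> Obj M"
  shows "Asc' Q R (C \<odot> D) \<cdot> (Idt M Q \<otimes> br_left C R D) \<cdot> br_left C Q (R \<odot> D) =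
    br_left C (Q \<odot> R) D \<cdot> (Idt M C \<otimes> Asc' Q R D)"
proof -
  let ?D = "Idt M D"
  \<comment> \<open>Composing \<open>hexagon1\<close> with inverse associators at both ends solves
    it for the braiding with \<open>Q \<odot> R\<close>.\<close>
  have "Asc' Q R C \<cdot> (Asc M Q R C \<cdot> Br M C (Q \<odot> R) \<cdot> Asc M C Q R) \<cdot> Asc' C Q R =
    Asc' Q R C \<cdot> ((Idt M Q \<otimes> Br M C R) \<cdot> Asc M Q C R \<cdot> (Br M C Q \<otimes> Idt M R)) \<cdot> Asc' C Q R"
    by (simp only: hexagon1[OF assms(1,3,4)])
  then have hex: "Br M C (Q \<odot> R) =
    Asc' Q R C \<cdot> (Idt M Q \<otimes> Br M C R) \<cdot> Asc M Q C R \<cdot> (Br M C Q \<otimes> Idt M R) \<cdot> Asc' C Q R"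
    by simp
  have "br_left C (Q \<odot> R) D \<cdot> (Idt M C \<otimes> Asc' Q R D) =
    Asc M (Q \<odot> R) C D \<cdot> (Asc' Q R C \<otimes> ?D) \<cdot> ((Idt M Q \<otimes> Br M C R) \<otimes> ?D) \<cdot> (Asc M Q C R \<otimes> ?D) \<cdot>
      ((Br M C Q \<otimes> Idt M R) \<otimes> ?D) \<cdot>
      ((Asc' C Q R \<otimes> ?D) \<cdot> Asc' C (Q \<odot> R) D \<cdot> (Idt M C \<otimes> Asc' Q R D))"
    by (simp add: br_left_def hex)
  also have "\<dots> = Asc M (Q \<odot> R) C D \<cdot> (Asc' Q R C \<otimes> ?D) \<cdot> ((Idt M Q \<otimes> Br M C R) \<otimes> ?D) \<cdot>
    (Asc M Q C R \<otimes> ?D) \<cdot>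
      (((Br M C Q \<otimes> Idt M R) \<otimes> ?D) \<cdot> Asc' (C \<odot> Q) R D) \<cdot> Asc' C Q (R \<odot> D)"
    by (subst pentagon_inv3) simp_all
  also have "((Br M C Q \<otimes> Idt M R) \<otimes> ?D) \<cdot> Asc' (C \<odot> Q) R D =
      Asc' (Q \<odot> C) R D \<cdot> (Br M C Q \<otimes> (Idt M R \<otimes> ?D))"
    by (subst asc'_nat) (simp_all del: tens_idt')
  also have "Asc M (Q \<odot> R) C D \<cdot> (Asc' Q R C \<otimes> ?D) \<cdot> ((Idt M Q \<otimes> Br M C R) \<otimes> ?D) \<cdot>
    (Asc M Q C R \<otimes> ?D) \<cdot>
      (Asc' (Q \<odot> C) R D \<cdot> (Br M C Q \<otimes> (Idt M R \<otimes> ?D))) \<cdot> Asc' C Q (R \<odot> D) =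
    Asc M (Q \<odot> R) C D \<cdot> (Asc' Q R C \<otimes> ?D) \<cdot> ((Idt M Q \<otimes> Br M C R) \<otimes> ?D) \<cdot>
      ((Asc M Q C R \<otimes> ?D) \<cdot> Asc' (Q \<odot> C) R D) \<cdot> (Br M C Q \<otimes> (Idt M R \<otimes> ?D)) \<cdot> Asc' C Q (R \<odot> D)"
    by simp
  also have "\<dots> = Asc M (Q \<odot> R) C D \<cdot> (Asc' Q R C \<otimes> ?D) \<cdot>
      (((Idt M Q \<otimes> Br M C R) \<otimes> ?D) \<cdot> Asc' Q (C \<odot> R) D) \<cdot>
      (Idt M Q \<otimes> Asc' C R D) \<cdot> br_left C Q (R \<odot> D)"
    by (subst pentagon_inv1) (simp_all add: br_left_def)
  also have "((Idt M Q \<otimes> Br M C R) \<otimes> ?D) \<cdot> Asc' Q (C \<odot> R) D =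
      Asc' Q (R \<odot> C) D \<cdot> (Idt M Q \<otimes> (Br M C R \<otimes> ?D))"
    by (subst asc'_nat) simp_all
  also have "Asc M (Q \<odot> R) C D \<cdot> (Asc' Q R C \<otimes> ?D) \<cdot>
      (Asc' Q (R \<odot> C) D \<cdot> (Idt M Q \<otimes> (Br M C R \<otimes> ?D))) \<cdot>
      (Idt M Q \<otimes> Asc' C R D) \<cdot> br_left C Q (R \<odot> D) =
    (Asc M (Q \<odot> R) C D \<cdot> (Asc' Q R C \<otimes> ?D) \<cdot> Asc' Q (R \<odot> C) D) \<cdot> (Idt M Q \<otimes> (Br M C R \<otimes> ?D)) \<cdot>
      (Idt M Q \<otimes> Asc' C R D) \<cdot> br_left C Q (R \<odot> D)"
    by simp
  also have "\<dots> = Asc' Q R (C \<odot> D) \<cdot> (Idt M Q \<otimes> br_left C R D) \<cdot> br_left C Q (R \<odot> D)"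
    by (subst pentagon_inv2) (simp_all add: br_left_def)
  finally show ?thesis
    by simp
qed

lemma middle_braid_eq:
  "middle_braid M W X Y Z = Asc' W Y (X \<odot> Z) \<cdot> (Idt M W \<otimes> br_left X Y Z) \<cdot> Asc M W X (Y \<odot> Z)"
  by (simp only: middle_braid_def br_left_def)

lemma middle_braid_simps [simp]:
  assumes "W \<in> Obj M" "X \<in> Obj M" "Y \<in> Obj M" "Z \<in> Obj M"
  shows "middle_braid M W X Y Z \<in> Arr M" "Dom M (middle_braid M W X Y Z) = (W \<odot> X) \<odot> (Y \<odot> Z)"
    "Cod M (middle_braid M W X Y Z) = (W \<odot> Y) \<odot> (X \<odot> Z)"
  using assms by (simp_all add: middle_braid_eq)

lemma middle_braid_nat:
  assumes "w \<in> Arr M" "x \<in> Arr M" "y \<in> Arr M" "z \<in> Arr M"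
    "Cod M w = W" "Cod M x = X" "Cod M y = Y" "Cod M z = Z"
  shows "middle_braid M W X Y Z \<cdot> ((w \<otimes> x) \<otimes> (y \<otimes> z)) =
    ((w \<otimes> y) \<otimes> (x \<otimes> z)) \<cdot> middle_braid M (Dom M w) (Dom M x) (Dom M y) (Dom M z)"
proof -
  have [simp]: "W \<in> Obj M" "X \<in> Obj M" "Y \<in> Obj M" "Z \<in> Obj M"
    using assms by auto
  note [simp] = assms
  let ?A = "Asc M (Dom M w) (Dom M x) (Dom M y \<odot> Dom M z)"
  have "middle_braid M W X Y Z \<cdot> ((w \<otimes> x) \<otimes> (y \<otimes> z)) =
    Asc' W Y (X \<odot> Z) \<cdot> (w \<otimes> (br_left X Y Z \<cdot> (x \<otimes> (y \<otimes> z)))) \<cdot> ?A"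
    by (simp add: middle_braid_eq asc_nat)
  also have "\<dots> = (Asc' W Y (X \<odot> Z) \<cdot> (w \<otimes> (y \<otimes> (x \<otimes> z)))) \<cdot>
      (Idt M (Dom M w) \<otimes> br_left (Dom M x) (Dom M y) (Dom M z)) \<cdot> ?A"
    by (simp add: br_left_nat)
  also have "\<dots> = ((w \<otimes> y) \<otimes> (x \<otimes> z)) \<cdot> middle_braid M (Dom M w) (Dom M x) (Dom M y) (Dom M z)"
    by (subst asc'_nat) (simp_all add: middle_braid_eq)
  finally show ?thesis .
qed

section \<open>Galois maps of tensor products\<close>

text \<open>
  Up to conjugation by the braiding the left factor is the Galois map of \<open>D\<close>; the equation is the
  hexagon together with naturality in \<open>Q\<close>.
\<close>

lemma galois_braid:
  assumes [simp]: "C \<in> Obj M" "D \<in> Obj M" and m: "m \<in> hom M (Q \<odot> Q) Q" and \<delta>: "\<delta> \<in> hom M D (Q \<odot> D)"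
  shows "((m \<otimes> Idt M (C \<odot> D)) \<cdot> Asc' Q Q (C \<odot> D) \<cdot> (Idt M Q \<otimes> (br_left C Q D \<cdot> (Idt M C \<otimes> \<delta>)))) \<cdot>
      br_left C Q D = br_left C Q D \<cdot> (Idt M C \<otimes> galois Q m D \<delta>)"
proof -
  note [simp] = homE[OF m] homE[OF \<delta>]
  let ?Q = "Idt M Q"
  let ?C = "Idt M C"
  let ?D = "Idt M D"
  have "((m \<otimes> Idt M (C \<odot> D)) \<cdot> Asc' Q Q (C \<odot> D) \<cdot> (?Q \<otimes> (br_left C Q D \<cdot> (?C \<otimes> \<delta>)))) \<cdot>
    br_left C Q D =
    (m \<otimes> (?C \<otimes> ?D)) \<cdot> Asc' Q Q (C \<odot> D) \<cdot> (?Q \<otimes> br_left C Q D) \<cdot>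
      ((?Q \<otimes> (?C \<otimes> \<delta>)) \<cdot> br_left C Q D)"
    by simp
  also have "(?Q \<otimes> (?C \<otimes> \<delta>)) \<cdot> br_left C Q D = br_left C Q (Q \<odot> D) \<cdot> (?C \<otimes> (?Q \<otimes> \<delta>))"
    by (subst br_left_nat) simp_all
  also have "(m \<otimes> (?C \<otimes> ?D)) \<cdot> Asc' Q Q (C \<odot> D) \<cdot> (?Q \<otimes> br_left C Q D) \<cdot> br_left C Q (Q \<odot> D) \<cdot>
      (?C \<otimes> (?Q \<otimes> \<delta>)) =
    (m \<otimes> (?C \<otimes> ?D)) \<cdot> (Asc' Q Q (C \<odot> D) \<cdot> (?Q \<otimes> br_left C Q D) \<cdot> br_left C Q (Q \<odot> D)) \<cdot>
      (?C \<otimes> (?Q \<otimes> \<delta>))"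
    by simp
  also have "\<dots> = ((m \<otimes> (?C \<otimes> ?D)) \<cdot> br_left C (Q \<odot> Q) D) \<cdot> (?C \<otimes> (Asc' Q Q D \<cdot> (?Q \<otimes> \<delta>)))"
    by (subst br_left_hexagon) simp_all
  also have "\<dots> = (br_left C Q D \<cdot> (?C \<otimes> (m \<otimes> ?D))) \<cdot> (?C \<otimes> (Asc' Q Q D \<cdot> (?Q \<otimes> \<delta>)))"
    by (subst br_left_nat) simp_all
  also have "\<dots> = br_left C Q D \<cdot> (?C \<otimes> galois Q m D \<delta>)"
    by (simp add: galois_def)
  finally show ?thesis .
qed

text \<open>On the right x \<otimes> (y \<otimes> z) is treated in two stages: y0 is multiplied into
  x, then z0 is braided past y1 and multiplied in as well. On the left y0 z0 is formed first, so the
  two sides differ only by associativity of \<open>m\<close> and coherence.\<close>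

lemma galois_tensor:
  assumes m: "m \<in> hom M (Q \<odot> Q) Q" and \<delta>: "\<delta> \<in> hom M C (Q \<odot> C)" and \<delta>': "\<delta>' \<in> hom M D (Q \<odot> D)"
    and ass: "m \<cdot> (m \<otimes> Idt M Q) = m \<cdot> (Idt M Q \<otimes> m) \<cdot> Asc M Q Q Q"
  shows "galois Q m (C \<odot> D) ((m \<otimes> Idt M (C \<odot> D)) \<cdot> middle_braid M Q C Q D \<cdot> (\<delta> \<otimes> \<delta>')) =
    ((m \<otimes> Idt M (C \<odot> D)) \<cdot> Asc' Q Q (C \<odot> D) \<cdot> (Idt M Q \<otimes> (br_left C Q D \<cdot> (Idt M C \<otimes> \<delta>')))) \<cdot>
      Asc M Q C D \<cdot> (galois Q m C \<delta> \<otimes> Idt M D) \<cdot> Asc' Q C D"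
proof -
  note [simp] = homE[OF m] homE[OF \<delta>] homE[OF \<delta>']
  let ?Q = "Idt M Q"
  let ?C = "Idt M C"
  let ?D = "Idt M D"
  \<comment> \<open>Both sides are brought to a form beginning with \<open>?N\<close>, the triple
    product bracketed as in the two-stage version.\<close>
  let ?N = "(m \<cdot> (m \<otimes> ?Q)) \<otimes> (?C \<otimes> ?D)"
  note [simp] = galois_simps[OF m \<delta>]
  have "((m \<otimes> Idt M (C \<odot> D)) \<cdot> Asc' Q Q (C \<odot> D) \<cdot> (?Q \<otimes> (br_left C Q D \<cdot> (?C \<otimes> \<delta>')))) \<cdot>
      Asc M Q C D \<cdot> (galois Q m C \<delta> \<otimes> ?D) \<cdot> Asc' Q C D =
    (m \<otimes> (?C \<otimes> ?D)) \<cdot> Asc' Q Q (C \<odot> D) \<cdot> (?Q \<otimes> br_left C Q D) \<cdot>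
      ((?Q \<otimes> (?C \<otimes> \<delta>')) \<cdot> Asc M Q C D) \<cdot> (galois Q m C \<delta> \<otimes> ?D) \<cdot> Asc' Q C D"
    by simp
  also have "(?Q \<otimes> (?C \<otimes> \<delta>')) \<cdot> Asc M Q C D = Asc M Q C (Q \<odot> D) \<cdot> ((?Q \<otimes> ?C) \<otimes> \<delta>')"
    by (subst asc_nat) simp_all
  also have "(m \<otimes> (?C \<otimes> ?D)) \<cdot> Asc' Q Q (C \<odot> D) \<cdot> (?Q \<otimes> br_left C Q D) \<cdot>
      (Asc M Q C (Q \<odot> D) \<cdot> ((?Q \<otimes> ?C) \<otimes> \<delta>')) \<cdot> (galois Q m C \<delta> \<otimes> ?D) \<cdot> Asc' Q C D =
    (m \<otimes> (?C \<otimes> ?D)) \<cdot> Asc' Q Q (C \<odot> D) \<cdot> (?Q \<otimes> br_left C Q D) \<cdot>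
      (Asc M Q C (Q \<odot> D) \<cdot> ((m \<otimes> ?C) \<otimes> (?Q \<otimes> ?D))) \<cdot> (Asc' Q Q C \<otimes> (?Q \<otimes> ?D)) \<cdot>
      (((?Q \<otimes> \<delta>) \<otimes> \<delta>') \<cdot> Asc' Q C D)"
    by (simp add: galois_def)
  also have "((?Q \<otimes> \<delta>) \<otimes> \<delta>') \<cdot> Asc' Q C D = Asc' Q (Q \<odot> C) (Q \<odot> D) \<cdot> (?Q \<otimes> (\<delta> \<otimes> \<delta>'))"
    by (subst asc'_nat) simp_all
  also have "Asc M Q C (Q \<odot> D) \<cdot> ((m \<otimes> ?C) \<otimes> (?Q \<otimes> ?D)) =
      (m \<otimes> (?C \<otimes> (?Q \<otimes> ?D))) \<cdot> Asc M (Q \<odot> Q) C (Q \<odot> D)"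
    by (subst asc_nat) simp_all
  also have "(m \<otimes> (?C \<otimes> ?D)) \<cdot> Asc' Q Q (C \<odot> D) \<cdot> (?Q \<otimes> br_left C Q D) \<cdot>
      ((m \<otimes> (?C \<otimes> (?Q \<otimes> ?D))) \<cdot> Asc M (Q \<odot> Q) C (Q \<odot> D)) \<cdot> (Asc' Q Q C \<otimes> (?Q \<otimes> ?D)) \<cdot>
      Asc' Q (Q \<odot> C) (Q \<odot> D) \<cdot> (?Q \<otimes> (\<delta> \<otimes> \<delta>')) =
    (m \<otimes> (?C \<otimes> ?D)) \<cdot> (Asc' Q Q (C \<odot> D) \<cdot> (m \<otimes> (?Q \<otimes> (?C \<otimes> ?D)))) \<cdot>
      (Idt M (Q \<odot> Q) \<otimes> br_left C Q D) \<cdot>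
      (Asc M (Q \<odot> Q) C (Q \<odot> D) \<cdot> (Asc' Q Q C \<otimes> Idt M (Q \<odot> D)) \<cdot>
      Asc' Q (Q \<odot> C) (Q \<odot> D)) \<cdot> (?Q \<otimes> (\<delta> \<otimes> \<delta>'))"
    by simp
  also have "\<dots> = (m \<otimes> (?C \<otimes> ?D)) \<cdot> (((m \<otimes> ?Q) \<otimes> (?C \<otimes> ?D)) \<cdot> Asc' (Q \<odot> Q) Q (C \<odot> D)) \<cdot>
      (Idt M (Q \<odot> Q) \<otimes> br_left C Q D) \<cdot>
      (Asc' Q Q (C \<odot> (Q \<odot> D)) \<cdot> (?Q \<otimes> Asc M Q C (Q \<odot> D))) \<cdot> (?Q \<otimes> (\<delta> \<otimes> \<delta>'))"
    by (subst asc'_nat) (simp_all add: pentagon_inv2)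
  finally have R: "((m \<otimes> Idt M (C \<odot> D)) \<cdot> Asc' Q Q (C \<odot> D) \<cdot> (?Q \<otimes> (br_left C Q D \<cdot> (?C \<otimes> \<delta>')))) \<cdot>
      Asc M Q C D \<cdot> (galois Q m C \<delta> \<otimes> ?D) \<cdot> Asc' Q C D =
    ?N \<cdot> Asc' (Q \<odot> Q) Q (C \<odot> D) \<cdot> (Idt M (Q \<odot> Q) \<otimes> br_left C Q D) \<cdot>
      Asc' Q Q (C \<odot> (Q \<odot> D)) \<cdot> (?Q \<otimes> (Asc M Q C (Q \<odot> D) \<cdot> (\<delta> \<otimes> \<delta>')))"
    by simp
  \<comment> \<open>\<open>?Y\<close> is the argument of the Galois map before its two
    \<open>Q\<close> factors are grouped and multiplied.\<close>
  let ?Y = "(Idt M Q \<otimes> br_left C Q D) \<cdot> Asc M Q C (Q \<odot> D) \<cdot> (\<delta> \<otimes> \<delta>')"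
  have "galois Q m (C \<odot> D) ((m \<otimes> Idt M (C \<odot> D)) \<cdot> middle_braid M Q C Q D \<cdot> (\<delta> \<otimes> \<delta>')) =
    (m \<otimes> (?C \<otimes> ?D)) \<cdot> (Asc' Q Q (C \<odot> D) \<cdot> (?Q \<otimes> (m \<otimes> (?C \<otimes> ?D)))) \<cdot>
      (?Q \<otimes> Asc' Q Q (C \<odot> D)) \<cdot> (?Q \<otimes> ?Y)"
    by (simp add: galois_def middle_braid_eq)
  also have "\<dots> = (m \<otimes> (?C \<otimes> ?D)) \<cdot> (((?Q \<otimes> m) \<otimes> (?C \<otimes> ?D)) \<cdot> Asc' Q (Q \<odot> Q) (C \<odot> D)) \<cdot>
      (?Q \<otimes> Asc' Q Q (C \<odot> D)) \<cdot> (?Q \<otimes> ?Y)"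
    by (subst asc'_nat) simp_all
  also have "\<dots> = ((m \<cdot> (?Q \<otimes> m)) \<otimes> (?C \<otimes> ?D)) \<cdot> (Asc' Q (Q \<odot> Q) (C \<odot> D) \<cdot>
      (?Q \<otimes> Asc' Q Q (C \<odot> D))) \<cdot> (?Q \<otimes> ?Y)"
    by simp
  \<comment> \<open>The pentagon supplies the associator that \<open>ass\<close> needs next to
    \<open>m \<cdot> (?Q \<otimes> m)\<close>.\<close>
  also have "\<dots> = ((m \<cdot> (?Q \<otimes> m)) \<otimes> (?C \<otimes> ?D)) \<cdot>
      ((Asc M Q Q Q \<otimes> Idt M (C \<odot> D)) \<cdot> Asc' (Q \<odot> Q) Q (C \<odot> D) \<cdot> Asc' Q Q (Q \<odot> (C \<odot> D))) \<cdot> (?Q \<otimes> ?Y)"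
    by (subst pentagon_inv4) simp_all
  also have "\<dots> = ?N \<cdot> Asc' (Q \<odot> Q) Q (C \<odot> D) \<cdot> (Asc' Q Q (Q \<odot> (C \<odot> D)) \<cdot>
      (?Q \<otimes> (?Q \<otimes> br_left C Q D))) \<cdot> (?Q \<otimes> (Asc M Q C (Q \<odot> D) \<cdot> (\<delta> \<otimes> \<delta>')))"
    by (simp add: ass)
  also have "\<dots> = ?N \<cdot> Asc' (Q \<odot> Q) Q (C \<odot> D) \<cdot> (((?Q \<otimes> ?Q) \<otimes> br_left C Q D) \<cdot>
      Asc' Q Q (C \<odot> (Q \<odot> D))) \<cdot> (?Q \<otimes> (Asc M Q C (Q \<odot> D) \<cdot> (\<delta> \<otimes> \<delta>')))"
    by (subst asc'_nat) simp_all
  finally show ?thesis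
    by (simp add: R)
qed

text \<open>Of the factors in \<open>galois_tensor\<close>, one is the Galois map of
  \<open>C\<close> tensored with \<open>D\<close> and conjugated by associators, the other is
  conjugate through \<open>br_left\<close> to that of \<open>D\<close>; both are therefore
  invertible.\<close>

lemma galois_tensor_iso:
  assumes m: "m \<in> hom M (Q \<odot> Q) Q" and \<delta>: "\<delta> \<in> hom M C (Q \<odot> C)" and \<delta>': "\<delta>' \<in> hom M D (Q \<odot> D)"
    and ass: "m \<cdot> (m \<otimes> Idt M Q) = m \<cdot> (Idt M Q \<otimes> m) \<cdot> Asc M Q Q Q"
    and iso: "iso_arrow M (galois Q m C \<delta>)" "iso_arrow M (galois Q m D \<delta>')"
  shows "iso_arrow M (galois Q m (C \<odot> D) ((m \<otimes> Idt M (C \<odot> D)) \<cdot> middle_braid M Q C Q D \<cdot> (\<delta> \<otimes> \<delta>')))"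
proof -
  note [simp] = homE[OF m] homE[OF \<delta>] homE[OF \<delta>']
  define G where "G = (m \<otimes> Idt M (C \<odot> D)) \<cdot> Asc' Q Q (C \<odot> D) \<cdot> (Idt M Q \<otimes> (br_left C Q D \<cdot>
    (Idt M C \<otimes> \<delta>')))"
  have [simp]: "G \<in> Arr M" "Dom M G = Q \<odot> (C \<odot> D)" "Cod M G = Q \<odot> (C \<odot> D)"
    by (simp_all add: G_def)
  \<comment> \<open>As \<open>br_left\<close> is invertible, \<open>galois_braid\<close> can be
    solved for \<open>G\<close>.\<close>
  have "G = (G \<cdot> br_left C Q D) \<cdot> inv_arrow M (br_left C Q D)"
    by simp
  also have "\<dots> = br_left C Q D \<cdot> (Idt M C \<otimes> galois Q m D \<delta>') \<cdot> inv_arrow M (br_left C Q D)"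
    unfolding G_def by (subst galois_braid[OF _ _ m \<delta>']) (simp_all add: m \<delta>')
  also have "iso_arrow M \<dots>"
    using iso m \<delta>' by (intro iso_comp iso_tens) (simp_all add: iso_idt iso_inv)
  finally have "iso_arrow M G" .
  then show ?thesis
    unfolding galois_tensor[OF m \<delta> \<delta>' ass] G_def[symmetric]
    using iso m \<delta> by (intro iso_comp iso_tens) (simp_all add: iso_idt iso_inv)
qed

text \<open>The conclusion has the form of the hypotheses, with arrow
  \<open>m \<cdot> (c \<otimes> c')\<close> and comultiplication
  \<open>middle_braid M C C D D \<cdot> (d \<otimes> d')\<close>, so it can be iterated. Naturality
  of \<open>middle_braid\<close> brings \<open>c\<close> and \<open>c'\<close> back to their own
  factors.\<close>

lemma convolution_iso_tensor:
  assumes Q: "monoid_object M Q m u"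
    and d: "d \<in> hom M C (C \<odot> C)" "d' \<in> hom M D (D \<odot> D)"
    and c: "c \<in> hom M C Q" "c' \<in> hom M D Q"
    and iso: "iso_arrow M (galois Q m C ((c \<otimes> Idt M C) \<cdot> d))"
      "iso_arrow M (galois Q m D ((c' \<otimes> Idt M D) \<cdot> d'))"
  shows "iso_arrow M (galois Q m (C \<odot> D)
    (((m \<cdot> (c \<otimes> c')) \<otimes> Idt M (C \<odot> D)) \<cdot> middle_braid M C C D D \<cdot> (d \<otimes> d')))"
proof -
  have m: "m \<in> hom M (Q \<odot> Q) Q"
    and ass: "m \<cdot> (m \<otimes> Idt M Q) = m \<cdot> (Idt M Q \<otimes> m) \<cdot> Asc M Q Q Q"
    using Q by (auto simp: monoid_object_def)
  note [simp] = homE[OF m] homE[OF d(1)] homE[OF d(2)] homE[OF c(1)] homE[OF c(2)]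
  have "((m \<cdot> (c \<otimes> c')) \<otimes> Idt M (C \<odot> D)) \<cdot> middle_braid M C C D D \<cdot> (d \<otimes> d') =
    (m \<otimes> Idt M (C \<odot> D)) \<cdot> (((c \<otimes> c') \<otimes> (Idt M C \<otimes> Idt M D)) \<cdot> middle_braid M C C D D) \<cdot> (d \<otimes> d')"
    by simp
  also have "((c \<otimes> c') \<otimes> (Idt M C \<otimes> Idt M D)) \<cdot> middle_braid M C C D D =
    middle_braid M Q C Q D \<cdot> ((c \<otimes> Idt M C) \<otimes> (c' \<otimes> Idt M D))"
    by (subst middle_braid_nat) simp_all
  finally have *: "((m \<cdot> (c \<otimes> c')) \<otimes> Idt M (C \<odot> D)) \<cdot> middle_braid M C C D D \<cdot> (d \<otimes> d') =
    (m \<otimes> Idt M (C \<odot> D)) \<cdot> middle_braid M Q C Q D \<cdot> (((c \<otimes> Idt M C) \<cdot> d) \<otimes> ((c' \<otimes> Idt M D) \<cdot> d'))"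
    by simp
  show ?thesis
    unfolding * by (intro galois_tensor_iso m ass iso) (simp_all add: homI)
qed

text \<open>
  The Galois maps \<open>G\<close> of \<open>c\<close> and \<open>G\<^sub>X\<close> of \<open>p\<close> satisfy \<open>G (Id \<otimes> h) = (Id \<otimes> h) G\<^sub>X\<close>, and likewise for \<open>k\<close>.
  Hence \<open>(Id \<otimes> c) G\<^sup>-\<^sup>1 (Id \<otimes> h) = (Id \<otimes> p) G\<^sub>X\<^sup>-\<^sup>1\<close> is the same for \<open>h\<close> and \<open>k\<close>, and \<open>c' h\<close> is recovered
  from it by the unit of \<open>Q\<close> and the counit.
\<close>

lemma convolution_inverse_determined:
  assumes Q: "monoid_object M Q m u" and B: "comonoid_object M B d e"
    and c: "c \<in> hom M B Q" "c' \<in> hom M B Q"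
    and inv: "m \<cdot> (c \<otimes> c') \<cdot> d = u \<cdot> e" "m \<cdot> (c' \<otimes> c) \<cdot> d = u \<cdot> e"
    and e': "e' \<in> hom M Q \<one>" "e' \<cdot> c = e"
    and d': "d' \<in> hom M X (X \<odot> X)"
    and h: "h \<in> hom M X B" "d \<cdot> h = (h \<otimes> h) \<cdot> d'" "c \<cdot> h = p"
    and k: "k \<in> hom M X B" "d \<cdot> k = (k \<otimes> k) \<cdot> d'" "c \<cdot> k = p"
    and iso: "iso_arrow M (galois Q m X ((p \<otimes> Idt M X) \<cdot> d'))"
  shows "c' \<cdot> h = c' \<cdot> k"
proof -
  have m: "m \<in> hom M (Q \<odot> Q) Q" and d: "d \<in> hom M B (B \<odot> B)" and u: "u \<in> hom M \<one> Q"
    and e: "e \<in> hom M B \<one>" and un: "m \<cdot> (u \<otimes> Idt M Q) = Lu M Q"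
    and coun: "Ru M B \<cdot> (Idt M B \<otimes> e) \<cdot> d = Idt M B"
    using Q B by (auto simp: monoid_object_def comonoid_object_def)
  have p: "p \<in> hom M X Q"
    using h c comp_hom by blast
  note [simp] =
    homE[OF m] homE[OF d] homE[OF u] homE[OF e] homE[OF c(1)] homE[OF c(2)] homE[OF e'(1)]
    homE[OF p] homE[OF d']
  let ?R = "galois Q m B ((c \<otimes> Idt M B) \<cdot> d)"
  let ?R' = "galois Q m B ((c' \<otimes> Idt M B) \<cdot> d)"
  let ?P = "galois Q m X ((p \<otimes> Idt M X) \<cdot> d')"
  have \<delta>: "(c \<otimes> Idt M B) \<cdot> d \<in> hom M B (Q \<odot> B)" "(c' \<otimes> Idt M B) \<cdot> d \<in> hom M B (Q \<odot> B)"
    "(p \<otimes> Idt M X) \<cdot> d' \<in> hom M X (Q \<odot> X)"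
    by (simp_all add: homI)
  note [simp] = galois_simps[OF m \<delta>(1)] galois_simps[OF m \<delta>(2)] galois_simps[OF m \<delta>(3)]
  have R: "?R' \<cdot> ?R = Idt M (Q \<odot> B)"
    using inverse_arrowsE[OF galois_iso[OF Q B c inv]] by simp
  have P: "((Idt M Q \<otimes> c) \<cdot> ?R' \<cdot> (Idt M Q \<otimes> h)) \<cdot> ?P = Idt M Q \<otimes> p"
    if h: "h \<in> hom M X B" "d \<cdot> h = (h \<otimes> h) \<cdot> d'" "c \<cdot> h = p" for h
  proof -
    note [simp] = homE[OF h(1)]
    have "?R \<cdot> (Idt M Q \<otimes> h) = (Idt M Q \<otimes> h) \<cdot> ?P"
      by (rule galois_natural[OF m \<delta>(3,1) h(1)]) (simp add: h)
    then have "((Idt M Q \<otimes> c) \<cdot> ?R' \<cdot> (Idt M Q \<otimes> h)) \<cdot> ?P = (Idt M Q \<otimes> c) \<cdot> (?R' \<cdot> ?R) \<cdot>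
      (Idt M Q \<otimes> h)"
      by simp
    also have "\<dots> = Idt M Q \<otimes> p"
      unfolding R by (simp add: h(3))
    finally show ?thesis .
  qed
  \<comment> \<open>Fed with the unit of \<open>Q\<close>, the composite sends x to c'(y1) \<otimes>
    c(y2) with y = h(x), up to unit constraints.\<close>
  have Z: "((Idt M Q \<otimes> c) \<cdot> ?R' \<cdot> (Idt M Q \<otimes> h)) \<cdot> (u \<otimes> Idt M X) =
      ((Lu M Q \<otimes> Idt M Q) \<cdot> Asc' \<one> Q Q) \<cdot> (Idt M \<one> \<otimes> ((c' \<otimes> c) \<cdot> d \<cdot> h))"
        if h: "h \<in> hom M X B" for h
  proof -
    note [simp] = homE[OF h]
    have "((Idt M Q \<otimes> c) \<cdot> ?R' \<cdot> (Idt M Q \<otimes> h)) \<cdot> (u \<otimes> Idt M X) =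
      (m \<otimes> Idt M Q) \<cdot> ((Idt M (Q \<odot> Q) \<otimes> c) \<cdot> Asc' Q Q B) \<cdot> (u \<otimes> ((c' \<otimes> Idt M B) \<cdot> d \<cdot> h))"
      by (simp add: galois_def)
    also have "(Idt M (Q \<odot> Q) \<otimes> c) \<cdot> Asc' Q Q B = Asc' Q Q Q \<cdot> (Idt M Q \<otimes> (Idt M Q \<otimes> c))"
      by (subst asc'_nat) simp_all
    also have "(m \<otimes> Idt M Q) \<cdot> (Asc' Q Q Q \<cdot> (Idt M Q \<otimes> (Idt M Q \<otimes> c))) \<cdot> (u \<otimes> ((c' \<otimes> Idt M B) \<cdot>
      d \<cdot> h)) =
      (m \<otimes> Idt M Q) \<cdot> (Asc' Q Q Q \<cdot> (u \<otimes> (Idt M Q \<otimes> Idt M Q))) \<cdot> (Idt M \<one> \<otimes> ((c' \<otimes> c) \<cdot> d \<cdot> h))"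
      by simp
    also have "\<dots> = (m \<otimes> Idt M Q) \<cdot> (((u \<otimes> Idt M Q) \<otimes> Idt M Q) \<cdot> Asc' \<one> Q Q) \<cdot>
        (Idt M \<one> \<otimes> ((c' \<otimes> c) \<cdot> d \<cdot> h))"
      by (subst asc'_nat) simp_all
    finally show ?thesis
      by (simp add: un)
  qed
  note [simp] = homE[OF h(1)] homE[OF k(1)]
  have "(Idt M Q \<otimes> c) \<cdot> ?R' \<cdot> (Idt M Q \<otimes> h) = (Idt M Q \<otimes> c) \<cdot> ?R' \<cdot> (Idt M Q \<otimes> k)"
    by (rule iso_cancel_right[OF iso]) (simp_all only: P[OF h] P[OF k], simp_all)
  then have "((Lu M Q \<otimes> Idt M Q) \<cdot> Asc' \<one> Q Q) \<cdot> (Idt M \<one> \<otimes> ((c' \<otimes> c) \<cdot> d \<cdot> h)) =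
    ((Lu M Q \<otimes> Idt M Q) \<cdot> Asc' \<one> Q Q) \<cdot> (Idt M \<one> \<otimes> ((c' \<otimes> c) \<cdot> d \<cdot> k))"
    by (simp only: Z[OF h(1), symmetric] Z[OF k(1), symmetric])
  then have "Idt M \<one> \<otimes> ((c' \<otimes> c) \<cdot> d \<cdot> h) = Idt M \<one> \<otimes> ((c' \<otimes> c) \<cdot> d \<cdot> k)"
    by (rule iso_cancel_left[rotated]) (simp_all add: iso_comp iso_tens iso_idt iso_inv)
  \<comment> \<open>Naturality of the left unit constraint strips the factor
    \<open>Idt M \<one>\<close>.\<close>
  then have "Lu M (Q \<odot> Q) \<cdot> (Idt M \<one> \<otimes> ((c' \<otimes> c) \<cdot> d \<cdot> h)) = Lu M (Q \<odot> Q) \<cdot>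
    (Idt M \<one> \<otimes> ((c' \<otimes> c) \<cdot> d \<cdot> k))"
    by (simp only:)
  then have "((c' \<otimes> c) \<cdot> d \<cdot> h) \<cdot> Lu M X = ((c' \<otimes> c) \<cdot> d \<cdot> k) \<cdot> Lu M X"
    by (subst (asm) (1 2) lu_nat) simp_all
  then have "(c' \<otimes> c) \<cdot> d \<cdot> h = (c' \<otimes> c) \<cdot> d \<cdot> k"
    by (rule iso_cancel_right[rotated]) simp_all
  \<comment> \<open>As \<open>e' \<cdot> c = e\<close>, applying \<open>e'\<close> to the second leg
    leaves the counit of \<open>B\<close>, which removes that leg.\<close>
  moreover have "Ru M Q \<cdot> (Idt M Q \<otimes> e') \<cdot> (c' \<otimes> c) \<cdot> d \<cdot> h = c' \<cdot> h" if h: "h \<in> hom M X B" for h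
  proof -
    note [simp] = homE[OF h]
    have "Ru M Q \<cdot> (Idt M Q \<otimes> e') \<cdot> (c' \<otimes> c) \<cdot> d \<cdot> h =
      (Ru M Q \<cdot> (c' \<otimes> Idt M \<one>)) \<cdot> (Idt M B \<otimes> e) \<cdot> d \<cdot> h"
      by (simp add: e'(2))
    also have "\<dots> = c' \<cdot> (Ru M B \<cdot> (Idt M B \<otimes> e) \<cdot> d) \<cdot> h"
      by (subst ru_nat) simp_all
    also have "\<dots> = c' \<cdot> h"
      unfolding coun by simp
    finally show ?thesis .
  qed
  ultimately show ?thesis
    using h(1) k(1) by metis
qed

text \<open>Naturality of \<open>middle_braid\<close> in all four arguments. It is applied twice to
  \<open>phi\<close>, once for each tensor product in its source.\<close>

lemma comultiplicative_tensor:
  assumes x: "x \<in> hom M X X'" "d\<^sub>1 \<in> hom M X (X \<odot> X)" "d\<^sub>1' \<in> hom M X' (X' \<odot> X')" "d\<^sub>1' \<cdot> x =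
    (x \<otimes> x) \<cdot> d\<^sub>1"
    and y: "y \<in> hom M Y Y'" "d\<^sub>2 \<in> hom M Y (Y \<odot> Y)" "d\<^sub>2' \<in> hom M Y' (Y' \<odot> Y')" "d\<^sub>2' \<cdot> y =
      (y \<otimes> y) \<cdot> d\<^sub>2"
  shows "(middle_braid M X' X' Y' Y' \<cdot> (d\<^sub>1' \<otimes> d\<^sub>2')) \<cdot> (x \<otimes> y) =
    ((x \<otimes> y) \<otimes> (x \<otimes> y)) \<cdot> middle_braid M X X Y Y \<cdot> (d\<^sub>1 \<otimes> d\<^sub>2)"
proof -
  note [simp] = homE[OF x(1)] homE[OF x(2)] homE[OF x(3)] homE[OF y(1)] homE[OF y(2)] homE[OF y(3)]
  have "(middle_braid M X' X' Y' Y' \<cdot> (d\<^sub>1' \<otimes> d\<^sub>2')) \<cdot> (x \<otimes> y) =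
    (middle_braid M X' X' Y' Y' \<cdot> ((x \<otimes> x) \<otimes> (y \<otimes> y))) \<cdot> (d\<^sub>1 \<otimes> d\<^sub>2)"
    by (simp add: x(4) y(4))
  also have "\<dots> = (((x \<otimes> y) \<otimes> (x \<otimes> y)) \<cdot> middle_braid M X X Y Y) \<cdot> (d\<^sub>1 \<otimes> d\<^sub>2)"
    by (subst middle_braid_nat) simp_all
  finally show ?thesis
    by simp
qed

section \<open>Tensor products of coequalizers\<close>

lemma coequalizer_tensor_left:
  "tensor_preserves_coequalizers M \<Longrightarrow> is_coequalizer M f g q \<Longrightarrow> X \<in> Obj M \<Longrightarrow>
    is_coequalizer M (Idt M X \<otimes> f) (Idt M X \<otimes> g) (Idt M X \<otimes> q)"
  by (simp add: tensor_preserves_coequalizers_def)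

lemma coequalizer_tensor_right:
  "tensor_preserves_coequalizers M \<Longrightarrow> is_coequalizer M f g q \<Longrightarrow> X \<in> Obj M \<Longrightarrow>
    is_coequalizer M (f \<otimes> Idt M X) (g \<otimes> Idt M X) (q \<otimes> Idt M X)"
  by (simp add: tensor_preserves_coequalizers_def)

text \<open>The arrow is \<open>p \<otimes> Id\<close> followed by \<open>Id \<otimes> q\<close>,
  and each factor is a coequalizer because tensoring preserves them.\<close>

lemma epi_tensor:
  assumes pres: "tensor_preserves_coequalizers M" and p: "is_coequalizer M f g p" and q: "is_coequalizer M h k q"
  shows "epi (p \<otimes> q)"
proof -
  note [simp] = coequalizer_simps[OF p] coequalizer_simps[OF q]
  have "epi (p \<otimes> Idt M (Dom M q))"
    by (rule coequalizer_epi[OF coequalizer_tensor_right[OF pres p]]) simp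
  moreover have "epi (Idt M (Cod M p) \<otimes> q)"
    by (rule coequalizer_epi[OF coequalizer_tensor_left[OF pres q]]) simp
  ultimately have "epi ((Idt M (Cod M p) \<otimes> q) \<cdot> (p \<otimes> Idt M (Dom M q)))"
    by (intro epi_comp) simp_all
  then show ?thesis
    by simp
qed

end

section \<open>The quotient Hopf monoid\<close>

context monoidal_category
begin

section \<open>Structure maps and axioms of Hopf monoids\<close>

lemmas hopf_unfold = hopf_monoid_def bimonoid_object_def monoid_object_def comonoid_object_def

lemma hopf_homs:
  assumes "hopf_monoid M H"
  shows "Car H \<in> Obj M" "mul H \<in> hom M (Car H \<odot> Car H) (Car H)" "unt H \<in> hom M \<one> (Car H)"
    "cmul H \<in> hom M (Car H) (Car H \<odot> Car H)" "cunt H \<in> hom M (Car H) \<one>" "antip H \<in> hom M (Car H) (Car H)"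
  using assms by (auto simp: hopf_unfold)

lemma hopf_arrs:
  assumes "hopf_monoid M H"
  shows "Car H \<in> Obj M"
    "mul H \<in> Arr M" "Dom M (mul H) = Car H \<odot> Car H" "Cod M (mul H) = Car H"
    "unt H \<in> Arr M" "Dom M (unt H) = \<one>" "Cod M (unt H) = Car H"
    "cmul H \<in> Arr M" "Dom M (cmul H) = Car H" "Cod M (cmul H) = Car H \<odot> Car H"
    "cunt H \<in> Arr M" "Dom M (cunt H) = Car H" "Cod M (cunt H) = \<one>"
    "antip H \<in> Arr M" "Dom M (antip H) = Car H" "Cod M (antip H) = Car H"
  using hopf_homs[OF assms] by (auto simp: hom_def)

lemma hopf_eqs:
  assumes "hopf_monoid M H"
  shows "mul H \<cdot> (mul H \<otimes> Idt M (Car H)) = mul H \<cdot> (Idt M (Car H) \<otimes> mul H) \<cdot>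
    Asc M (Car H) (Car H) (Car H)"
    "mul H \<cdot> (unt H \<otimes> Idt M (Car H)) = Lu M (Car H)"
    "mul H \<cdot> (Idt M (Car H) \<otimes> unt H) = Ru M (Car H)"
    "Asc M (Car H) (Car H) (Car H) \<cdot> (cmul H \<otimes> Idt M (Car H)) \<cdot> cmul H =
      (Idt M (Car H) \<otimes> cmul H) \<cdot> cmul H"
    "Lu M (Car H) \<cdot> (cunt H \<otimes> Idt M (Car H)) \<cdot> cmul H = Idt M (Car H)"
    "Ru M (Car H) \<cdot> (Idt M (Car H) \<otimes> cunt H) \<cdot> cmul H = Idt M (Car H)"
    "cmul H \<cdot> mul H = (mul H \<otimes> mul H) \<cdot> middle_braid M (Car H) (Car H) (Car H) (Car H) \<cdot>
      (cmul H \<otimes> cmul H)"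
    "cmul H \<cdot> unt H = (unt H \<otimes> unt H) \<cdot> inv_arrow M (Lu M \<one>)"
    "cunt H \<cdot> mul H = Lu M \<one> \<cdot> (cunt H \<otimes> cunt H)"
    "cunt H \<cdot> unt H = Idt M \<one>"
    "mul H \<cdot> (antip H \<otimes> Idt M (Car H)) \<cdot> cmul H = unt H \<cdot> cunt H"
    "mul H \<cdot> (Idt M (Car H) \<otimes> antip H) \<cdot> cmul H = unt H \<cdot> cunt H"
  using assms by (auto simp: hopf_unfold)

lemma morphism_arrs:
  assumes "hopf_monoid_morphism M H K h"
  shows "h \<in> Arr M" "Dom M h = Car H" "Cod M h = Car K"
  using assms by (auto simp: hopf_monoid_morphism_def hom_def)

lemma morphism_eqs:
  assumes "hopf_monoid_morphism M H K h"
  shows "h \<cdot> mul H = mul K \<cdot> (h \<otimes> h)" "h \<cdot> unt H = unt K" "cmul K \<cdot> h = (h \<otimes> h) \<cdot> cmul H"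
    "cunt K \<cdot> h = cunt H" "h \<cdot> antip H = antip K \<cdot> h"
  using assms by (auto simp: hopf_monoid_morphism_def)

end

text \<open>Here \<open>f\<close> and \<open>g\<close> are arrows of \<open>M\<close>; the packaged
  arrows of \<open>Hopf M\<close> come back only when the universal property is stated
  there.\<close>

locale hopf_coequalizer = braided_monoidal_category M
  for M :: "('o, 'm, 'x) braided_data_scheme" (structure) +
  fixes A B :: "('o, 'm) hopf_data" and f g \<pi> :: 'm
  assumes pres: "tensor_preserves_coequalizers M"
    and A: "hopf_monoid M A" and B: "hopf_monoid M B"
    and f: "hopf_monoid_morphism M A B f" and g: "hopf_monoid_morphism M A B g"
    and coeq: "is_coequalizer M (phi M B f) (phi M B g) \<pi>"
begin

abbreviation (input) "a \<equiv> Car A"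
abbreviation (input) "b \<equiv> Car B"
abbreviation (input) "Q \<equiv> Cod M \<pi>"
abbreviation (input) "m \<equiv> mul B"
abbreviation (input) "u \<equiv> unt B"
abbreviation (input) "d \<equiv> cmul B"
abbreviation (input) "e \<equiv> cunt B"
abbreviation (input) "S \<equiv> antip B"

lemmas arrs [simp] = hopf_arrs[OF A] hopf_arrs[OF B] morphism_arrs[OF f] morphism_arrs[OF g]

lemma phi_eq: "h \<in> hom M a b \<Longrightarrow> phi M B h = m \<cdot> ((m \<cdot> (Idt M b \<otimes> h)) \<otimes> Idt M b)"
  by (simp add: phi_def homE)

lemma phi_simps [simp]:
  assumes "h \<in> Arr M" "Dom M h = a" "Cod M h = b"
  shows "phi M B h \<in> Arr M" "Dom M (phi M B h) = (b \<odot> a) \<odot> b" "Cod M (phi M B h) = b"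
  using assms by (simp_all add: phi_def)

section \<open>The coequalizer and its tensor powers\<close>

lemma pi_simps [simp]: "\<pi> \<in> Arr M" "Dom M \<pi> = b"
  using coequalizer_simps[OF coeq] by simp_all

lemma Q_obj [simp]: "Q \<in> Obj M"
  by (rule obj_simps) simp

lemma pi_phi: "\<pi> \<cdot> phi M B f = \<pi> \<cdot> phi M B g"
  using coequalizer_simps(7)[OF coeq] .

lemma epi_pi: "epi \<pi>"
  by (rule coequalizer_epi[OF coeq])

lemma coeq_left: "X \<in> Obj M \<Longrightarrow>
    is_coequalizer M (Idt M X \<otimes> phi M B f) (Idt M X \<otimes> phi M B g) (Idt M X \<otimes> \<pi>)"
  by (rule coequalizer_tensor_left[OF pres coeq])

lemma coeq_right: "X \<in> Obj M \<Longrightarrow>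
    is_coequalizer M (phi M B f \<otimes> Idt M X) (phi M B g \<otimes> Idt M X) (\<pi> \<otimes> Idt M X)"
  by (rule coequalizer_tensor_right[OF pres coeq])

lemma epi_pi_left: "X \<in> Obj M \<Longrightarrow> epi (Idt M X \<otimes> \<pi>)"
  by (rule coequalizer_epi[OF coeq_left])

lemma epi_pi_right: "X \<in> Obj M \<Longrightarrow> epi (\<pi> \<otimes> Idt M X)"
  by (rule coequalizer_epi[OF coeq_right])

lemma epi_pi2: "epi (\<pi> \<otimes> \<pi>)"
  by (rule epi_tensor[OF pres coeq coeq])

text \<open>One factor is replaced at a time, each time by a coequalizer tensored with identities.
  The brackets are those of the source of the associativity law for the quotient.\<close>

lemma epi_pi3: "epi ((\<pi> \<otimes> \<pi>) \<otimes> \<pi>)"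
proof -
  have "epi ((Idt M Q \<otimes> \<pi>) \<otimes> Idt M b)"
    by (rule coequalizer_epi[OF coequalizer_tensor_right[OF pres coeq_left]]) simp_all
  moreover have "epi ((\<pi> \<otimes> Idt M b) \<otimes> Idt M b)"
    by (rule coequalizer_epi[OF coequalizer_tensor_right[OF pres coeq_right]]) simp_all
  ultimately have "epi (((Idt M Q \<otimes> \<pi>) \<otimes> Idt M b) \<cdot> ((\<pi> \<otimes> Idt M b) \<otimes> Idt M b))"
    by (intro epi_comp) simp_all
  then have "epi ((\<pi> \<otimes> \<pi>) \<otimes> Idt M b)"
    by simp
  then have "epi ((Idt M (Q \<odot> Q) \<otimes> \<pi>) \<cdot> ((\<pi> \<otimes> \<pi>) \<otimes> Idt M b))"
    using epi_pi_left[of "Q \<odot> Q"] by (intro epi_comp) simp_all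
  then show ?thesis
    by simp
qed

lemma descend:
  assumes "h \<in> hom M b Y" "h \<cdot> phi M B f = h \<cdot> phi M B g"
  shows "\<exists>k. k \<in> hom M Q Y \<and> k \<cdot> \<pi> = h"
proof -
  note [simp] = homE[OF assms(1)]
  have "\<exists>!k. k \<in> hom M Q (Cod M h) \<and> k \<cdot> \<pi> = h"
    by (rule coequalizer_factor[OF coeq]) (use assms in simp_all)
  then show ?thesis
    by auto
qed

section \<open>Compatibility of \<open>phi\<close> with the Hopf structure of
  \<open>B\<close>\<close>

lemma assoc_inv: "m \<cdot> (Idt M b \<otimes> m) = m \<cdot> (m \<otimes> Idt M b) \<cdot> Asc' b b b"
proof -
  have "(m \<cdot> (m \<otimes> Idt M b)) \<cdot> Asc' b b b = m \<cdot> (Idt M b \<otimes> m)"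
    unfolding hopf_eqs(1)[OF B] by simp
  then show ?thesis
    by simp
qed

text \<open>In generalised elements (x h(y) z) w = x h(y) (z w), so \<open>phi M B h\<close> is
  right \<open>B\<close>-linear. The arrow precomposed on the right-hand side is the same for every
  \<open>h\<close>, which lets right multiplication descend to the quotient.\<close>

lemma mul_phi_left:
  assumes "h \<in> hom M a b"
  shows "m \<cdot> (phi M B h \<otimes> Idt M b) = phi M B h \<cdot> (Idt M (b \<odot> a) \<otimes> m) \<cdot> Asc M (b \<odot> a) b b"
proof -
  note [simp] = homE[OF assms]
  let ?k = "m \<cdot> (Idt M b \<otimes> h)"
  have "m \<cdot> (phi M B h \<otimes> Idt M b) = (m \<cdot> (m \<otimes> Idt M b)) \<cdot> ((?k \<otimes> Idt M b) \<otimes> Idt M b)"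
    by (simp add: phi_eq[OF assms])
  also have "\<dots> = m \<cdot> (Idt M b \<otimes> m) \<cdot> (Asc M b b b \<cdot> ((?k \<otimes> Idt M b) \<otimes> Idt M b))"
    unfolding hopf_eqs(1)[OF B] by simp
  also have "\<dots> = m \<cdot> (Idt M b \<otimes> m) \<cdot> ((?k \<otimes> (Idt M b \<otimes> Idt M b)) \<cdot> Asc M (b \<odot> a) b b)"
    by (subst asc_nat) simp_all
  also have "\<dots> = phi M B h \<cdot> (Idt M (b \<odot> a) \<otimes> m) \<cdot> Asc M (b \<odot> a) b b"
    by (simp add: phi_eq[OF assms])
  finally show ?thesis .
qed

text \<open>The counterpart w (x h(y) z) = (w x) h(y) z: \<open>phi M B h\<close> is also left
  \<open>B\<close>-linear, again through an arrow independent of \<open>h\<close>.\<close>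

lemma mul_phi_right:
  assumes "h \<in> hom M a b"
  shows "m \<cdot> (Idt M b \<otimes> phi M B h) =
    phi M B h \<cdot> (((m \<otimes> Idt M a) \<cdot> Asc' b b a) \<otimes> Idt M b) \<cdot> Asc' b (b \<odot> a) b"
proof -
  note [simp] = homE[OF assms]
  let ?b = "Idt M b"
  let ?k = "m \<cdot> (?b \<otimes> h)"
  have "m \<cdot> (?b \<otimes> ?k) = (m \<cdot> (?b \<otimes> m)) \<cdot> (?b \<otimes> (?b \<otimes> h))"
    by simp
  also have "\<dots> = m \<cdot> (m \<otimes> ?b) \<cdot> (Asc' b b b \<cdot> (?b \<otimes> (?b \<otimes> h)))"
    unfolding assoc_inv by simp
  also have "\<dots> = m \<cdot> (m \<otimes> ?b) \<cdot> (((?b \<otimes> ?b) \<otimes> h) \<cdot> Asc' b b a)"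
    by (subst asc'_nat) simp_all
  finally have k: "m \<cdot> (?b \<otimes> ?k) = ?k \<cdot> (m \<otimes> Idt M a) \<cdot> Asc' b b a"
    by simp
  have "m \<cdot> (?b \<otimes> phi M B h) = (m \<cdot> (?b \<otimes> m)) \<cdot> (?b \<otimes> (?k \<otimes> ?b))"
    by (simp add: phi_eq[OF assms])
  also have "\<dots> = m \<cdot> (m \<otimes> ?b) \<cdot> (Asc' b b b \<cdot> (?b \<otimes> (?k \<otimes> ?b)))"
    unfolding assoc_inv by simp
  also have "\<dots> = m \<cdot> (m \<otimes> ?b) \<cdot> (((?b \<otimes> ?k) \<otimes> ?b) \<cdot> Asc' b (b \<odot> a) b)"
    by (subst asc'_nat) simp_all
  also have "\<dots> = m \<cdot> ((m \<cdot> (?b \<otimes> ?k)) \<otimes> ?b) \<cdot> Asc' b (b \<odot> a) b"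
    by simp
  also have "\<dots> = phi M B h \<cdot> (((m \<otimes> Idt M a) \<cdot> Asc' b b a) \<otimes> Idt M b) \<cdot> Asc' b (b \<odot> a) b"
    unfolding k by (simp add: phi_eq[OF assms])
  finally show ?thesis .
qed

lemma f_hom: "f \<in> hom M a b" and g_hom: "g \<in> hom M a b"
  by (simp_all add: homI)

text \<open>Feeding the unit of \<open>B\<close> into both outer slots of \<open>\<phi>\<^sub>h\<close> returns \<open>h\<close>.\<close>

lemma pi_f: "\<pi> \<cdot> f = \<pi> \<cdot> g"
proof -
  have *: "phi M B h \<cdot> (Idt M (b \<odot> a) \<otimes> u) \<cdot> inv_arrow M (Ru M (b \<odot> a)) \<cdot> (u \<otimes> Idt M a) \<cdot>
    inv_arrow M (Lu M a) = h"
    if h: "h \<in> hom M a b" for h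
  proof -
    note [simp] = homE[OF h]
    let ?k = "m \<cdot> (Idt M b \<otimes> h)"
    have "phi M B h \<cdot> (Idt M (b \<odot> a) \<otimes> u) \<cdot> inv_arrow M (Ru M (b \<odot> a)) \<cdot> (u \<otimes> Idt M a) \<cdot>
      inv_arrow M (Lu M a) =
      (m \<cdot> (Idt M b \<otimes> u)) \<cdot> (?k \<otimes> Idt M \<one>) \<cdot> inv_arrow M (Ru M (b \<odot> a)) \<cdot> (u \<otimes> Idt M a) \<cdot>
        inv_arrow M (Lu M a)"
      by (simp add: phi_eq[OF h])
    also have "\<dots> = (Ru M b \<cdot> (?k \<otimes> Idt M \<one>)) \<cdot> inv_arrow M (Ru M (b \<odot> a)) \<cdot> (u \<otimes> Idt M a) \<cdot>
      inv_arrow M (Lu M a)"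
      unfolding hopf_eqs(3)[OF B] by simp
    also have "\<dots> = (?k \<cdot> Ru M (b \<odot> a)) \<cdot> inv_arrow M (Ru M (b \<odot> a)) \<cdot> (u \<otimes> Idt M a) \<cdot>
      inv_arrow M (Lu M a)"
      by (subst ru_nat) simp_all
    also have "\<dots> = (m \<cdot> (u \<otimes> Idt M b)) \<cdot> (Idt M \<one> \<otimes> h) \<cdot> inv_arrow M (Lu M a)"
      by simp
    also have "\<dots> = (Lu M b \<cdot> (Idt M \<one> \<otimes> h)) \<cdot> inv_arrow M (Lu M a)"
      unfolding hopf_eqs(2)[OF B] by simp
    also have "\<dots> = h"
      by (subst lu_nat) simp_all
    finally show ?thesis .
  qed
  let ?r = "(Idt M (b \<odot> a) \<otimes> u) \<cdot> inv_arrow M (Ru M (b \<odot> a)) \<cdot> (u \<otimes> Idt M a) \<cdot> inv_arrow M (Lu M a)"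
  have "(\<pi> \<cdot> phi M B f) \<cdot> ?r = (\<pi> \<cdot> phi M B g) \<cdot> ?r"
    by (simp only: pi_phi)
  then have "\<pi> \<cdot> (phi M B f \<cdot> ?r) = \<pi> \<cdot> (phi M B g \<cdot> ?r)"
    by simp
  then show ?thesis
    by (simp only: *[OF f_hom] *[OF g_hom])
qed

text \<open>For multiplicative \<open>k\<close> the composite depends on \<open>h\<close> only
  through \<open>k \<cdot> h\<close>. Hence such a \<open>k\<close> that coequalizes
  \<open>f\<close> and \<open>g\<close> also coequalizes the two arrows \<open>phi\<close>.\<close>

lemma phi_monoid_morphism:
  assumes h: "h \<in> hom M a b" and k: "k \<in> hom M b (Car H)" and H: "hopf_monoid M H"
    and mul: "k \<cdot> m = mul H \<cdot> (k \<otimes> k)"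
  shows "k \<cdot> phi M B h = mul H \<cdot> ((mul H \<cdot> (k \<otimes> (k \<cdot> h))) \<otimes> k)"
proof -
  note [simp] = homE[OF h] homE[OF k] hopf_arrs[OF H]
  have "k \<cdot> phi M B h = (k \<cdot> m) \<cdot> ((m \<cdot> (Idt M b \<otimes> h)) \<otimes> Idt M b)"
    by (simp add: phi_eq[OF h])
  also have "\<dots> = (mul H \<cdot> (k \<otimes> k)) \<cdot> ((m \<cdot> (Idt M b \<otimes> h)) \<otimes> Idt M b)"
    unfolding mul ..
  also have "\<dots> = mul H \<cdot> (((k \<cdot> m) \<cdot> (Idt M b \<otimes> h)) \<otimes> k)"
    by simp
  also have "\<dots> = mul H \<cdot> ((mul H \<cdot> (k \<otimes> (k \<cdot> h))) \<otimes> k)"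
    unfolding mul by simp
  finally show ?thesis .
qed

text \<open>The braided tensor product comultiplication on B \<otimes> A \<otimes> B, built in two
  stages so that \<open>comultiplicative_tensor\<close> and \<open>convolution_iso_tensor\<close>
  apply to it.\<close>

definition cmul_dom :: 'm
  where "cmul_dom = middle_braid M (b \<odot> a) (b \<odot> a) b b \<cdot> ((middle_braid M b b a a \<cdot>
    (d \<otimes> cmul A)) \<otimes> d)"

lemma cmul_dom_simps [simp]:
  "cmul_dom \<in> Arr M" "Dom M cmul_dom = (b \<odot> a) \<odot> b" "Cod M cmul_dom = ((b \<odot> a) \<odot> b) \<odot> ((b \<odot> a) \<odot> b)"
  by (simp_all add: cmul_dom_def)

text \<open>\<open>phi M B h\<close> is assembled from identities, \<open>h\<close> and
  \<open>m\<close>, all comultiplicative: \<open>h\<close> as a Hopf morphism, \<open>m\<close> by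
  the bimonoid axiom. The same \<open>cmul_dom\<close> serves \<open>f\<close> and
  \<open>g\<close>.\<close>

lemma phi_cmul:
  assumes "hopf_monoid_morphism M A B h"
  shows "d \<cdot> phi M B h = (phi M B h \<otimes> phi M B h) \<cdot> cmul_dom"
proof -
  note [simp] = morphism_arrs[OF assms]
  have h: "h \<in> hom M a b"
    by (simp add: homI)
  let ?b = "Idt M b"
  let ?k = "m \<cdot> (?b \<otimes> h)"
  let ?dk = "middle_braid M b b a a \<cdot> (d \<otimes> cmul A)"
  have "d \<cdot> ?k = (d \<cdot> m) \<cdot> (?b \<otimes> h)"
    by simp
  also have "\<dots> = (m \<otimes> m) \<cdot> ((middle_braid M b b b b \<cdot> (d \<otimes> d)) \<cdot> (?b \<otimes> h))"
    unfolding hopf_eqs(7)[OF B] by simp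
  also have "\<dots> = (m \<otimes> m) \<cdot> ((?b \<otimes> h) \<otimes> (?b \<otimes> h)) \<cdot> ?dk"
    using comultiplicative_tensor[of ?b b b d d h a b "cmul A" d]
    by (simp add: homI morphism_eqs(3)[OF assms])
  finally have k: "d \<cdot> ?k = (?k \<otimes> ?k) \<cdot> ?dk"
    by simp
  have "d \<cdot> phi M B h = (d \<cdot> m) \<cdot> (?k \<otimes> ?b)"
    by (simp add: phi_eq[OF h])
  also have "\<dots> = (m \<otimes> m) \<cdot> ((middle_braid M b b b b \<cdot> (d \<otimes> d)) \<cdot> (?k \<otimes> ?b))"
    unfolding hopf_eqs(7)[OF B] by simp
  also have "\<dots> = (m \<otimes> m) \<cdot> ((?k \<otimes> ?b) \<otimes> (?k \<otimes> ?b)) \<cdot> cmul_dom"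
    using comultiplicative_tensor[of ?k "b \<odot> a" b ?dk d ?b b b d d] k
    by (simp add: homI cmul_dom_def)
  finally show ?thesis
    by (simp add: phi_eq[OF h])
qed

text \<open>As \<open>cunt B \<cdot> h = cunt A\<close>, the right-hand side is free of
  \<open>h\<close>, so the counit of \<open>B\<close> coequalizes the two arrows
  \<open>phi\<close>.\<close>

lemma phi_cunt:
  assumes "hopf_monoid_morphism M A B h"
  shows "e \<cdot> phi M B h = Lu M \<one> \<cdot> ((Lu M \<one> \<cdot> (e \<otimes> cunt A)) \<otimes> e)"
proof -
  note [simp] = morphism_arrs[OF assms]
  have h: "h \<in> hom M a b"
    by (simp add: homI)
  have "e \<cdot> phi M B h = (e \<cdot> m) \<cdot> ((m \<cdot> (Idt M b \<otimes> h)) \<otimes> Idt M b)"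
    by (simp add: phi_eq[OF h])
  also have "\<dots> = (Lu M \<one> \<cdot> (e \<otimes> e)) \<cdot> ((m \<cdot> (Idt M b \<otimes> h)) \<otimes> Idt M b)"
    unfolding hopf_eqs(9)[OF B] ..
  also have "\<dots> = Lu M \<one> \<cdot> (((e \<cdot> m) \<cdot> (Idt M b \<otimes> h)) \<otimes> e)"
    by simp
  also have "\<dots> = Lu M \<one> \<cdot> ((Lu M \<one> \<cdot> (e \<otimes> cunt A)) \<otimes> e)"
    unfolding hopf_eqs(9)[OF B] by (simp add: morphism_eqs(4)[OF assms])
  finally show ?thesis .
qed

section \<open>Bimonoid structure on the quotient\<close>

lemma mulQ_exists: "\<exists>k. k \<in> hom M (Q \<odot> Q) Q \<and> k \<cdot> (\<pi> \<otimes> \<pi>) = \<pi> \<cdot> m"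
proof -
  \<comment> \<open>The multiplication descends in two stages, first in its left argument.\<close>
  have "(\<pi> \<cdot> m) \<cdot> (phi M B f \<otimes> Idt M b) = (\<pi> \<cdot> phi M B f) \<cdot> (Idt M (b \<odot> a) \<otimes> m) \<cdot> Asc M (b \<odot> a) b b"
    by (simp add: mul_phi_left[OF f_hom])
  also have "\<dots> = (\<pi> \<cdot> m) \<cdot> (phi M B g \<otimes> Idt M b)"
    unfolding pi_phi by (simp add: mul_phi_left[OF g_hom])
  finally have "\<exists>!k. k \<in> hom M (Cod M (\<pi> \<otimes> Idt M b)) (Cod M (\<pi> \<cdot> m)) \<and> k \<cdot> (\<pi> \<otimes> Idt M b) = \<pi> \<cdot> m"
    by (intro coequalizer_factor[OF coeq_right]) simp_all
  then obtain k where k: "k \<in> hom M (Q \<odot> b) Q" and k_eq: "k \<cdot> (\<pi> \<otimes> Idt M b) = \<pi> \<cdot> m"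
    by auto
  note [simp] = homE[OF k]
  \<comment> \<open>The second stage is checked after precomposing with an epimorphism, where
    \<open>k\<close> becomes \<open>\<pi> \<cdot> m\<close> and left linearity of \<open>phi\<close>
    applies.\<close>
  have split: "(k \<cdot> (Idt M Q \<otimes> phi M B h)) \<cdot> (\<pi> \<otimes> Idt M ((b \<odot> a) \<odot> b)) =
    (\<pi> \<cdot> phi M B h) \<cdot> (((m \<otimes> Idt M a) \<cdot> Asc' b b a) \<otimes> Idt M b) \<cdot> Asc' b (b \<odot> a) b"
      if h: "h \<in> hom M a b" for h
  proof -
    note [simp] = homE[OF h]
    have "(k \<cdot> (Idt M Q \<otimes> phi M B h)) \<cdot> (\<pi> \<otimes> Idt M ((b \<odot> a) \<odot> b)) =
      (k \<cdot> (\<pi> \<otimes> Idt M b)) \<cdot> (Idt M b \<otimes> phi M B h)"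
      by simp
    also have "\<dots> = \<pi> \<cdot> (m \<cdot> (Idt M b \<otimes> phi M B h))"
      unfolding k_eq by simp
    finally show ?thesis
      unfolding mul_phi_right[OF h] by simp
  qed
  have "k \<cdot> (Idt M Q \<otimes> phi M B f) = k \<cdot> (Idt M Q \<otimes> phi M B g)"
    by (rule epiD[OF epi_pi_right[of "(b \<odot> a) \<odot> b"]])
      (simp_all only: split[OF f_hom] split[OF g_hom] pi_phi, simp_all)
  then have "\<exists>!l. l \<in> hom M (Cod M (Idt M Q \<otimes> \<pi>)) (Cod M k) \<and> l \<cdot> (Idt M Q \<otimes> \<pi>) = k"
    by (intro coequalizer_factor[OF coeq_left]) simp_all
  then obtain l where l: "l \<in> hom M (Q \<odot> Q) Q" and l_eq: "l \<cdot> (Idt M Q \<otimes> \<pi>) = k"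
    by auto
  note [simp] = homE[OF l]
  have "l \<cdot> (\<pi> \<otimes> \<pi>) = (l \<cdot> (Idt M Q \<otimes> \<pi>)) \<cdot> (\<pi> \<otimes> Idt M b)"
    by simp
  then show ?thesis
    using l by (auto simp: l_eq k_eq simp del: assoc interchange)
qed

text \<open>The choice is harmless, since \<pi> \<otimes> \<pi> is epic and the equation determines
  the arrow. The other descended maps are chosen likewise, with \<pi> in place of \<pi> \<otimes>
  \<pi>.\<close>

definition mulQ :: 'm
  where "mulQ = (SOME k. k \<in> hom M (Q \<odot> Q) Q \<and> k \<cdot> (\<pi> \<otimes> \<pi>) = \<pi> \<cdot> m)"

lemma mulQ: "mulQ \<in> hom M (Q \<odot> Q) Q" "mulQ \<cdot> (\<pi> \<otimes> \<pi>) = \<pi> \<cdot> m"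
  using someI_ex[OF mulQ_exists] by (simp_all add: mulQ_def)

text \<open>After \<open>phi_cmul\<close>, the arrow \<open>h\<close> enters only through
  \<open>\<pi> \<cdot> phi M B h\<close>, and \<open>pi_phi\<close> applies.\<close>

lemma cmulQ_exists: "\<exists>k. k \<in> hom M Q (Q \<odot> Q) \<and> k \<cdot> \<pi> = (\<pi> \<otimes> \<pi>) \<cdot> d"
proof (rule descend)
  have "((\<pi> \<otimes> \<pi>) \<cdot> d) \<cdot> phi M B h = ((\<pi> \<cdot> phi M B h) \<otimes> (\<pi> \<cdot> phi M B h)) \<cdot> cmul_dom"
    if h: "hopf_monoid_morphism M A B h" for h
  proof -
    note [simp] = morphism_arrs[OF h]
    show ?thesis
      by (simp add: phi_cmul[OF h])
  qed
  then show "((\<pi> \<otimes> \<pi>) \<cdot> d) \<cdot> phi M B f = ((\<pi> \<otimes> \<pi>) \<cdot> d) \<cdot> phi M B g"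
    using f g by (simp only: pi_phi)
qed (simp add: homI)

definition cmulQ :: 'm
  where "cmulQ = (SOME k. k \<in> hom M Q (Q \<odot> Q) \<and> k \<cdot> \<pi> = (\<pi> \<otimes> \<pi>) \<cdot> d)"

lemma cmulQ: "cmulQ \<in> hom M Q (Q \<odot> Q)" "cmulQ \<cdot> \<pi> = (\<pi> \<otimes> \<pi>) \<cdot> d"
  using someI_ex[OF cmulQ_exists] by (simp_all add: cmulQ_def)

lemma cuntQ_exists: "\<exists>k. k \<in> hom M Q \<one> \<and> k \<cdot> \<pi> = e"
  by (rule descend) (simp_all add: homI phi_cunt[OF f] phi_cunt[OF g])

definition cuntQ :: 'm
  where "cuntQ = (SOME k. k \<in> hom M Q \<one> \<and> k \<cdot> \<pi> = e)"

lemma cuntQ: "cuntQ \<in> hom M Q \<one>" "cuntQ \<cdot> \<pi> = e"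
  using someI_ex[OF cuntQ_exists] by (simp_all add: cuntQ_def)

lemmas Q_simps [simp] = homE(1-3)[OF mulQ(1)] homE(1-3)[OF cmulQ(1)] homE(1-3)[OF cuntQ(1)]

text \<open>Each axiom is precomposed with the tensor product of copies of \<pi> and identities that
  covers its source. There it becomes the image under \<pi> of the axiom for \<open>B\<close>, and
  the epimorphism is cancelled.\<close>

lemma monoid_Q: "monoid_object M Q mulQ (\<pi> \<cdot> u)"
  unfolding monoid_object_def
proof (intro conjI)
  have "(mulQ \<cdot> (mulQ \<otimes> Idt M Q)) \<cdot> ((\<pi> \<otimes> \<pi>) \<otimes> \<pi>) = mulQ \<cdot> ((mulQ \<cdot> (\<pi> \<otimes> \<pi>)) \<otimes> \<pi>)"
    by simp
  also have "\<dots> = mulQ \<cdot> ((\<pi> \<cdot> m) \<otimes> \<pi>)"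
    by (simp only: mulQ(2))
  also have "\<dots> = (mulQ \<cdot> (\<pi> \<otimes> \<pi>)) \<cdot> (m \<otimes> Idt M b)"
    by simp
  also have "\<dots> = \<pi> \<cdot> (m \<cdot> (m \<otimes> Idt M b))"
    unfolding mulQ by simp
  also have "\<dots> = (mulQ \<cdot> (\<pi> \<otimes> \<pi>)) \<cdot> (Idt M b \<otimes> m) \<cdot> Asc M b b b"
    unfolding mulQ hopf_eqs(1)[OF B] by simp
  also have "\<dots> = mulQ \<cdot> (\<pi> \<otimes> (\<pi> \<cdot> m)) \<cdot> Asc M b b b"
    by simp
  also have "\<dots> = mulQ \<cdot> (Idt M Q \<otimes> mulQ) \<cdot> ((\<pi> \<otimes> (\<pi> \<otimes> \<pi>)) \<cdot> Asc M b b b)"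
    unfolding mulQ(2)[symmetric] by simp
  also have "(\<pi> \<otimes> (\<pi> \<otimes> \<pi>)) \<cdot> Asc M b b b = Asc M Q Q Q \<cdot> ((\<pi> \<otimes> \<pi>) \<otimes> \<pi>)"
    by (subst asc_nat) simp_all
  finally have "(mulQ \<cdot> (mulQ \<otimes> Idt M Q)) \<cdot> ((\<pi> \<otimes> \<pi>) \<otimes> \<pi>) =
    (mulQ \<cdot> (Idt M Q \<otimes> mulQ) \<cdot> Asc M Q Q Q) \<cdot> ((\<pi> \<otimes> \<pi>) \<otimes> \<pi>)"
    by simp
  then show "mulQ \<cdot> (mulQ \<otimes> Idt M Q) = mulQ \<cdot> (Idt M Q \<otimes> mulQ) \<cdot> Asc M Q Q Q"
    by (rule epiD[OF epi_pi3]) simp_all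
  have "(mulQ \<cdot> ((\<pi> \<cdot> u) \<otimes> Idt M Q)) \<cdot> (Idt M \<one> \<otimes> \<pi>) = (mulQ \<cdot> (\<pi> \<otimes> \<pi>)) \<cdot> (u \<otimes> Idt M b)"
    by simp
  also have "\<dots> = \<pi> \<cdot> (m \<cdot> (u \<otimes> Idt M b))"
    unfolding mulQ by simp
  also have "\<dots> = Lu M Q \<cdot> (Idt M \<one> \<otimes> \<pi>)"
    unfolding hopf_eqs(2)[OF B] by (subst lu_nat) simp_all
  finally show "mulQ \<cdot> ((\<pi> \<cdot> u) \<otimes> Idt M Q) = Lu M Q"
    by (rule epiD[OF epi_pi_left[OF unit_obj]]) simp_all
  have "(mulQ \<cdot> (Idt M Q \<otimes> (\<pi> \<cdot> u))) \<cdot> (\<pi> \<otimes> Idt M \<one>) = (mulQ \<cdot> (\<pi> \<otimes> \<pi>)) \<cdot> (Idt M b \<otimes> u)"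
    by simp
  also have "\<dots> = \<pi> \<cdot> (m \<cdot> (Idt M b \<otimes> u))"
    unfolding mulQ by simp
  also have "\<dots> = Ru M Q \<cdot> (\<pi> \<otimes> Idt M \<one>)"
    unfolding hopf_eqs(3)[OF B] by (subst ru_nat) simp_all
  finally show "mulQ \<cdot> (Idt M Q \<otimes> (\<pi> \<cdot> u)) = Ru M Q"
    by (rule epiD[OF epi_pi_right[OF unit_obj]]) simp_all
qed (simp_all add: homI mulQ)

text \<open>All three laws have source \<open>Q\<close>, so \<pi> alone is cancelled; the
  constraints are passed by naturality.\<close>

lemma comonoid_Q: "comonoid_object M Q cmulQ cuntQ"
  unfolding comonoid_object_def
proof (intro conjI)
  have "(Asc M Q Q Q \<cdot> (cmulQ \<otimes> Idt M Q) \<cdot> cmulQ) \<cdot> \<pi> =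
    Asc M Q Q Q \<cdot> (cmulQ \<otimes> Idt M Q) \<cdot> (\<pi> \<otimes> \<pi>) \<cdot> d"
    by (simp add: cmulQ(2))
  also have "\<dots> = Asc M Q Q Q \<cdot> ((\<pi> \<otimes> \<pi>) \<otimes> \<pi>) \<cdot> (d \<otimes> Idt M b) \<cdot> d"
    by (simp add: cmulQ(2))
  also have "\<dots> = (Asc M Q Q Q \<cdot> ((\<pi> \<otimes> \<pi>) \<otimes> \<pi>)) \<cdot> (d \<otimes> Idt M b) \<cdot> d"
    by simp
  also have "\<dots> = (\<pi> \<otimes> (\<pi> \<otimes> \<pi>)) \<cdot> (Asc M b b b \<cdot> (d \<otimes> Idt M b) \<cdot> d)"
    by (subst asc_nat) simp_all
  also have "\<dots> = (\<pi> \<otimes> (\<pi> \<otimes> \<pi>)) \<cdot> (Idt M b \<otimes> d) \<cdot> d"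
    unfolding hopf_eqs(4)[OF B] ..
  also have "\<dots> = ((Idt M Q \<otimes> cmulQ) \<cdot> cmulQ) \<cdot> \<pi>"
    by (simp add: cmulQ(2))
  finally show "Asc M Q Q Q \<cdot> (cmulQ \<otimes> Idt M Q) \<cdot> cmulQ = (Idt M Q \<otimes> cmulQ) \<cdot> cmulQ"
    by (rule epiD[OF epi_pi]) simp_all
  have "(Lu M Q \<cdot> (cuntQ \<otimes> Idt M Q) \<cdot> cmulQ) \<cdot> \<pi> = (Lu M Q \<cdot> (Idt M \<one> \<otimes> \<pi>)) \<cdot> (e \<otimes> Idt M b) \<cdot> d"
    by (simp add: cmulQ(2) cuntQ(2))
  also have "\<dots> = \<pi> \<cdot> (Lu M b \<cdot> (e \<otimes> Idt M b) \<cdot> d)"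
    by (subst lu_nat) simp_all
  also have "\<dots> = Idt M Q \<cdot> \<pi>"
    unfolding hopf_eqs(5)[OF B] by simp
  finally show "Lu M Q \<cdot> (cuntQ \<otimes> Idt M Q) \<cdot> cmulQ = Idt M Q"
    by (rule epiD[OF epi_pi]) simp_all
  have "(Ru M Q \<cdot> (Idt M Q \<otimes> cuntQ) \<cdot> cmulQ) \<cdot> \<pi> = (Ru M Q \<cdot> (\<pi> \<otimes> Idt M \<one>)) \<cdot> (Idt M b \<otimes> e) \<cdot> d"
    by (simp add: cmulQ(2) cuntQ(2))
  also have "\<dots> = \<pi> \<cdot> (Ru M b \<cdot> (Idt M b \<otimes> e) \<cdot> d)"
    by (subst ru_nat) simp_all
  also have "\<dots> = Idt M Q \<cdot> \<pi>"
    unfolding hopf_eqs(6)[OF B] by simp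
  finally show "Ru M Q \<cdot> (Idt M Q \<otimes> cuntQ) \<cdot> cmulQ = Idt M Q"
    by (rule epiD[OF epi_pi]) simp_all
qed (simp_all add: homI cmulQ cuntQ)

lemma bimonoid_Q: "bimonoid_object M Q mulQ (\<pi> \<cdot> u) cmulQ cuntQ"
  unfolding bimonoid_object_def
proof (intro conjI monoid_Q comonoid_Q)
  have "(cmulQ \<cdot> mulQ) \<cdot> (\<pi> \<otimes> \<pi>) = (cmulQ \<cdot> \<pi>) \<cdot> m"
    by (simp add: mulQ)
  also have "\<dots> = (\<pi> \<otimes> \<pi>) \<cdot> (d \<cdot> m)"
    unfolding cmulQ by simp
  also have "\<dots> = ((\<pi> \<cdot> m) \<otimes> (\<pi> \<cdot> m)) \<cdot> middle_braid M b b b b \<cdot> (d \<otimes> d)"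
    unfolding hopf_eqs(7)[OF B] by simp
  also have "\<dots> = (mulQ \<otimes> mulQ) \<cdot> (((\<pi> \<otimes> \<pi>) \<otimes> (\<pi> \<otimes> \<pi>)) \<cdot> middle_braid M b b b b) \<cdot> (d \<otimes> d)"
    unfolding mulQ(2)[symmetric] by simp
  also have "((\<pi> \<otimes> \<pi>) \<otimes> (\<pi> \<otimes> \<pi>)) \<cdot> middle_braid M b b b b =
      middle_braid M Q Q Q Q \<cdot> ((\<pi> \<otimes> \<pi>) \<otimes> (\<pi> \<otimes> \<pi>))"
    by (subst middle_braid_nat) simp_all
  also have "(mulQ \<otimes> mulQ) \<cdot> (middle_braid M Q Q Q Q \<cdot> ((\<pi> \<otimes> \<pi>) \<otimes> (\<pi> \<otimes> \<pi>))) \<cdot> (d \<otimes> d) =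
    ((mulQ \<otimes> mulQ) \<cdot> middle_braid M Q Q Q Q \<cdot> (cmulQ \<otimes> cmulQ)) \<cdot> (\<pi> \<otimes> \<pi>)"
    by (simp add: cmulQ(2))
  finally show "cmulQ \<cdot> mulQ = (mulQ \<otimes> mulQ) \<cdot> middle_braid M Q Q Q Q \<cdot> (cmulQ \<otimes> cmulQ)"
    by (rule epiD[OF epi_pi2]) simp_all
  \<comment> \<open>The unit axioms have source \<open>\<one>\<close> and the unit is
    \<open>\<pi> \<cdot> u\<close>, so they follow from those of \<open>B\<close> with no
    epimorphism to cancel.\<close>
  have "cmulQ \<cdot> \<pi> \<cdot> u = (cmulQ \<cdot> \<pi>) \<cdot> u"
    by simp
  also have "\<dots> = (\<pi> \<otimes> \<pi>) \<cdot> (d \<cdot> u)"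
    unfolding cmulQ by simp
  also have "\<dots> = ((\<pi> \<cdot> u) \<otimes> (\<pi> \<cdot> u)) \<cdot> inv_arrow M (Lu M \<one>)"
    unfolding hopf_eqs(8)[OF B] by simp
  finally show "cmulQ \<cdot> \<pi> \<cdot> u = ((\<pi> \<cdot> u) \<otimes> (\<pi> \<cdot> u)) \<cdot> inv_arrow M (Lu M \<one>)" .
  have "(cuntQ \<cdot> mulQ) \<cdot> (\<pi> \<otimes> \<pi>) = (cuntQ \<cdot> \<pi>) \<cdot> m"
    by (simp add: mulQ)
  also have "\<dots> = (Lu M \<one> \<cdot> (cuntQ \<otimes> cuntQ)) \<cdot> (\<pi> \<otimes> \<pi>)"
    by (simp add: cuntQ(2) hopf_eqs(9)[OF B])
  finally show "cuntQ \<cdot> mulQ = Lu M \<one> \<cdot> (cuntQ \<otimes> cuntQ)"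
    by (rule epiD[OF epi_pi2]) simp_all
  have "cuntQ \<cdot> \<pi> \<cdot> u = (cuntQ \<cdot> \<pi>) \<cdot> u"
    by simp
  also have "\<dots> = Idt M \<one>"
    unfolding cuntQ by (rule hopf_eqs(10)[OF B])
  finally show "cuntQ \<cdot> \<pi> \<cdot> u = Idt M \<one>" .
qed

section \<open>The antipode of the quotient\<close>

lemma pi_convolution:
  assumes h: "h \<in> hom M X b" and k: "k \<in> hom M X b" and d': "d' \<in> hom M X (X \<odot> X)"
  shows "mulQ \<cdot> ((\<pi> \<cdot> h) \<otimes> (\<pi> \<cdot> k)) \<cdot> d' = \<pi> \<cdot> m \<cdot> (h \<otimes> k) \<cdot> d'"
proof -
  note [simp] = homE[OF h] homE[OF k] homE[OF d']
  have "mulQ \<cdot> ((\<pi> \<cdot> h) \<otimes> (\<pi> \<cdot> k)) \<cdot> d' = (mulQ \<cdot> (\<pi> \<otimes> \<pi>)) \<cdot> (h \<otimes> k) \<cdot> d'"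
    by simp
  then show ?thesis
    by (simp add: mulQ)
qed

text \<open>A multiplicative and unital arrow carries the antipode identities of \<open>H\<close> to
  convolution identities in the quotient. A general \<open>H\<close> covers both uses:
  \<open>B\<close> with the identity, and \<open>A\<close> with \<open>f\<close>.\<close>

lemma pi_morphism_inverse:
  assumes H: "hopf_monoid M H" and h: "hopf_monoid_morphism M H B h"
  shows "mulQ \<cdot> ((\<pi> \<cdot> h) \<otimes> (\<pi> \<cdot> h \<cdot> antip H)) \<cdot> cmul H = (\<pi> \<cdot> u) \<cdot> cunt H"
    and "mulQ \<cdot> ((\<pi> \<cdot> h \<cdot> antip H) \<otimes> (\<pi> \<cdot> h)) \<cdot> cmul H = (\<pi> \<cdot> u) \<cdot> cunt H"
proof -
  note [simp] = morphism_arrs[OF h] hopf_arrs[OF H]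
  have hh: "h \<in> hom M (Car H) b" "h \<cdot> antip H \<in> hom M (Car H) b"
    by (simp_all add: homI)
  have "\<pi> \<cdot> m \<cdot> (h \<otimes> (h \<cdot> antip H)) \<cdot> cmul H = \<pi> \<cdot> (m \<cdot> (h \<otimes> h)) \<cdot> (Idt M (Car H) \<otimes> antip H) \<cdot>
    cmul H"
    by simp
  also have "\<dots> = \<pi> \<cdot> h \<cdot> (mul H \<cdot> (Idt M (Car H) \<otimes> antip H) \<cdot> cmul H)"
    unfolding morphism_eqs(1)[OF h, symmetric] by simp
  also have "\<dots> = \<pi> \<cdot> (h \<cdot> unt H) \<cdot> cunt H"
    unfolding hopf_eqs(12)[OF H] by simp
  also have "\<dots> = (\<pi> \<cdot> u) \<cdot> cunt H"
    unfolding morphism_eqs(2)[OF h] by simp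
  finally show "mulQ \<cdot> ((\<pi> \<cdot> h) \<otimes> (\<pi> \<cdot> h \<cdot> antip H)) \<cdot> cmul H = (\<pi> \<cdot> u) \<cdot> cunt H"
    by (simp add: pi_convolution[OF hh hopf_homs(4)[OF H]])
  have "\<pi> \<cdot> m \<cdot> ((h \<cdot> antip H) \<otimes> h) \<cdot> cmul H = \<pi> \<cdot> (m \<cdot> (h \<otimes> h)) \<cdot> (antip H \<otimes> Idt M (Car H)) \<cdot>
    cmul H"
    by simp
  also have "\<dots> = \<pi> \<cdot> h \<cdot> (mul H \<cdot> (antip H \<otimes> Idt M (Car H)) \<cdot> cmul H)"
    unfolding morphism_eqs(1)[OF h, symmetric] by simp
  also have "\<dots> = \<pi> \<cdot> (h \<cdot> unt H) \<cdot> cunt H"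
    unfolding hopf_eqs(11)[OF H] by simp
  also have "\<dots> = (\<pi> \<cdot> u) \<cdot> cunt H"
    unfolding morphism_eqs(2)[OF h] by simp
  finally show "mulQ \<cdot> ((\<pi> \<cdot> h \<cdot> antip H) \<otimes> (\<pi> \<cdot> h)) \<cdot> cmul H = (\<pi> \<cdot> u) \<cdot> cunt H"
    by (simp add: pi_convolution[OF hh(2,1) hopf_homs(4)[OF H]])
qed

lemma pi_morphism_iso:
  assumes H: "hopf_monoid M H" and h: "hopf_monoid_morphism M H B h"
  shows "iso_arrow M (galois Q mulQ (Car H) (((\<pi> \<cdot> h) \<otimes> Idt M (Car H)) \<cdot> cmul H))"
proof -
  note [simp] = morphism_arrs[OF h] hopf_arrs[OF H]
  have "comonoid_object M (Car H) (cmul H) (cunt H)"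
    using H by (simp add: hopf_unfold)
  from galois_iso[OF monoid_Q this _ _ pi_morphism_inverse[OF H h]]
  show ?thesis
    by (auto simp: iso_arrow_def homI)
qed

lemma id_morphism: "hopf_monoid_morphism M B B (Idt M b)"
  by (simp add: hopf_monoid_morphism_def homI)

lemma antipQ_exists: "\<exists>k. k \<in> hom M Q Q \<and> k \<cdot> \<pi> = \<pi> \<cdot> S"
proof (rule descend)
  \<comment> \<open>\<open>?p\<close> sends x \<otimes> y \<otimes> z to \<pi>(x) \<pi>(f(y))
    \<pi>(z). It is \<open>\<pi> \<cdot> phi M B f\<close> written as a product in the quotient, the
    form in which \<open>convolution_iso_tensor\<close> works factor by factor.\<close>
  let ?pk = "mulQ \<cdot> (\<pi> \<otimes> (\<pi> \<cdot> f))"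
  let ?p = "mulQ \<cdot> (?pk \<otimes> \<pi>)"
  have iso_b: "iso_arrow M (galois Q mulQ b ((\<pi> \<otimes> Idt M b) \<cdot> d))"
    using pi_morphism_iso[OF B id_morphism] by simp
  have iso_ba: "iso_arrow M (galois Q mulQ (b \<odot> a)
      ((?pk \<otimes> Idt M (b \<odot> a)) \<cdot> (middle_braid M b b a a \<cdot> (d \<otimes> cmul A))))"
    by (rule convolution_iso_tensor[OF monoid_Q])
      (use iso_b pi_morphism_iso[OF A f] in \<open>simp_all add: homI\<close>)
  have iso: "iso_arrow M (galois Q mulQ ((b \<odot> a) \<odot> b) ((?p \<otimes> Idt M ((b \<odot> a) \<odot> b)) \<cdot> cmul_dom))"
    unfolding cmul_dom_def
    by (rule convolution_iso_tensor[OF monoid_Q _ _ _ _ iso_ba iso_b]) (simp_all add: homI)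
  have phi_f: "\<pi> \<cdot> phi M B f = ?p"
  proof -
    have "\<pi> \<cdot> phi M B f = (\<pi> \<cdot> m) \<cdot> ((m \<cdot> (Idt M b \<otimes> f)) \<otimes> Idt M b)"
      by (simp add: phi_eq[OF f_hom])
    also have "\<dots> = (mulQ \<cdot> (\<pi> \<otimes> \<pi>)) \<cdot> ((m \<cdot> (Idt M b \<otimes> f)) \<otimes> Idt M b)"
      unfolding mulQ(2) ..
    also have "\<dots> = mulQ \<cdot> (((\<pi> \<cdot> m) \<cdot> (Idt M b \<otimes> f)) \<otimes> \<pi>)"
      by simp
    also have "\<dots> = ?p"
      unfolding mulQ(2)[symmetric] by simp
    finally show ?thesis .
  qed
  have B': "comonoid_object M b d e"
    using B by (simp add: hopf_unfold)
  \<comment> \<open>Here \<open>c'\<close> is \<open>\<pi> \<cdot> S\<close>, the convolution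
    inverse of \<pi>. The arrows \<open>phi\<close> of \<open>f\<close> and \<open>g\<close> have
    the same composite \<open>?p\<close> with \<pi> and are comultiplicative for the same
    \<open>cmul_dom\<close>.\<close>
  show "(\<pi> \<cdot> S) \<cdot> phi M B f = (\<pi> \<cdot> S) \<cdot> phi M B g"
    by (rule convolution_inverse_determined[OF monoid_Q B', where c = \<pi> and e' = cuntQ and p =
      ?p and d' = cmul_dom
          and X = "(b \<odot> a) \<odot> b"])
      (use iso pi_morphism_inverse[OF B id_morphism] phi_f
        in \<open>simp_all add: homI cuntQ phi_cmul[OF f] phi_cmul[OF g] pi_phi[symmetric]\<close>)
qed (simp add: homI)

definition antipQ :: 'm
  where "antipQ = (SOME k. k \<in> hom M Q Q \<and> k \<cdot> \<pi> = \<pi> \<cdot> S)"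

lemma antipQ: "antipQ \<in> hom M Q Q" "antipQ \<cdot> \<pi> = \<pi> \<cdot> S"
  using someI_ex[OF antipQ_exists] by (simp_all add: antipQ_def)

lemmas antipQ_simps [simp] = homE(1-3)[OF antipQ(1)]

section \<open>Uniqueness of the Hopf structure and universal property\<close>

definition quot :: "('o, 'm) hopf_data"
  where "quot = \<lparr>Car = Q, mul = mulQ, unt = \<pi> \<cdot> u, cmul = cmulQ, cunt = cuntQ, antip = antipQ\<rparr>"

lemma hopf_quot: "hopf_monoid M quot"
proof -
  have "(mulQ \<cdot> (antipQ \<otimes> Idt M Q) \<cdot> cmulQ) \<cdot> \<pi> = mulQ \<cdot> ((\<pi> \<cdot> S) \<otimes> \<pi>) \<cdot> d"
    by (simp add: cmulQ(2) antipQ(2))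
  also have "\<dots> = ((\<pi> \<cdot> u) \<cdot> cuntQ) \<cdot> \<pi>"
    using pi_morphism_inverse(2)[OF B id_morphism] by (simp add: cuntQ(2))
  finally have l: "mulQ \<cdot> (antipQ \<otimes> Idt M Q) \<cdot> cmulQ = (\<pi> \<cdot> u) \<cdot> cuntQ"
    by (rule epiD[OF epi_pi]) simp_all
  have "(mulQ \<cdot> (Idt M Q \<otimes> antipQ) \<cdot> cmulQ) \<cdot> \<pi> = mulQ \<cdot> (\<pi> \<otimes> (\<pi> \<cdot> S)) \<cdot> d"
    by (simp add: cmulQ(2) antipQ(2))
  also have "\<dots> = ((\<pi> \<cdot> u) \<cdot> cuntQ) \<cdot> \<pi>"
    using pi_morphism_inverse(1)[OF B id_morphism] by (simp add: cuntQ(2))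
  finally have r: "mulQ \<cdot> (Idt M Q \<otimes> antipQ) \<cdot> cmulQ = (\<pi> \<cdot> u) \<cdot> cuntQ"
    by (rule epiD[OF epi_pi]) simp_all
  show ?thesis
    using bimonoid_Q l r antipQ(1) by (simp add: hopf_monoid_def quot_def)
qed

lemma morphism_quot: "hopf_monoid_morphism M B quot \<pi>"
  by (simp add: hopf_monoid_morphism_def quot_def homI mulQ cmulQ cuntQ antipQ)

text \<open>For each operation of \<open>H\<close> a composite with \<pi> or \<pi> \<otimes> \<pi>
  is dictated by \<open>B\<close>, and these arrows are epic; the unit is dictated directly.\<close>

lemma quot_unique:
  assumes "Car H = Q" and H: "hopf_monoid M H" and h: "hopf_monoid_morphism M B H \<pi>"
  shows "H = quot"
proof -
  note [simp] = assms(1) hopf_arrs[OF H] hopf_arrs[OF hopf_quot]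
  have [simp]: "Car quot = Q"
    by (simp add: quot_def)
  have "mul H = mul quot"
    by (rule epiD[OF epi_pi2]) (simp_all add: morphism_eqs(1)[OF h, symmetric]
      morphism_eqs(1)[OF morphism_quot, symmetric])
  moreover have "unt H = unt quot"
    using morphism_eqs(2)[OF h] morphism_eqs(2)[OF morphism_quot] by simp
  moreover have "cmul H = cmul quot"
    by (rule epiD[OF epi_pi]) (simp_all add: morphism_eqs(3)[OF h]
      morphism_eqs(3)[OF morphism_quot])
  moreover have "cunt H = cunt quot"
    by (rule epiD[OF epi_pi]) (simp_all add: morphism_eqs(4)[OF h]
      morphism_eqs(4)[OF morphism_quot])
  moreover have "antip H = antip quot"
    by (rule epiD[OF epi_pi])
      (simp_all add: morphism_eqs(5)[OF h, symmetric] morphism_eqs(5)[OF morphism_quot, symmetric])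
  ultimately show ?thesis
    by (intro hopf_data.equality) simp_all
qed

text \<open>\<open>phi_monoid_morphism\<close> turns \<open>eq\<close> into the condition for
  factoring in \<open>M\<close>. The factor inherits the morphism equations of \<open>h\<close> by
  cancelling \<pi> or \<pi> \<otimes> \<pi>, and the unit equation directly.\<close>

lemma factor_morphism:
  assumes K: "hopf_monoid M K" and h: "hopf_monoid_morphism M B K h" and eq: "h \<cdot> f = h \<cdot> g"
  shows "\<exists>!k. hopf_monoid_morphism M quot K k \<and> k \<cdot> \<pi> = h"
proof -
  note [simp] = hopf_arrs[OF K] morphism_arrs[OF h] hopf_arrs[OF hopf_quot]
  have [simp]: "Car quot = Q"
    by (simp add: quot_def)
  have hh: "h \<in> hom M b (Car K)"
    by (simp add: homI)
  have "h \<cdot> phi M B f = h \<cdot> phi M B g"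
    unfolding phi_monoid_morphism[OF f_hom hh K morphism_eqs(1)[OF h]]
      phi_monoid_morphism[OF g_hom hh K morphism_eqs(1)[OF h]] eq ..
  then obtain k where k: "k \<in> hom M Q (Car K)" and kh: "k \<cdot> \<pi> = h"
    using descend[OF hh] by blast
  note [simp] = homE(1-3)[OF k]
  have [simp]: "k \<cdot> \<pi> \<cdot> r = h \<cdot> r" if "r \<in> Arr M" "Cod M r = b" for r
    using comp_chain[OF kh, of r] that by simp
  have "(k \<cdot> mul quot) \<cdot> (\<pi> \<otimes> \<pi>) = (mul K \<cdot> (k \<otimes> k)) \<cdot> (\<pi> \<otimes> \<pi>)"
    by (simp add: morphism_eqs(1)[OF morphism_quot, symmetric] morphism_eqs(1)[OF h] kh)
  then have "k \<cdot> mul quot = mul K \<cdot> (k \<otimes> k)"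
    by (rule epiD[OF epi_pi2]) simp_all
  moreover have "k \<cdot> unt quot = unt K"
    by (simp add: morphism_eqs(2)[OF h] morphism_eqs(2)[OF morphism_quot, symmetric])
  moreover have "(cmul K \<cdot> k) \<cdot> \<pi> = ((k \<otimes> k) \<cdot> cmul quot) \<cdot> \<pi>"
    by (simp add: kh morphism_eqs(3)[OF h] morphism_eqs(3)[OF morphism_quot])
  then have "cmul K \<cdot> k = (k \<otimes> k) \<cdot> cmul quot"
    by (rule epiD[OF epi_pi]) simp_all
  moreover have "(cunt K \<cdot> k) \<cdot> \<pi> = cunt quot \<cdot> \<pi>"
    by (simp add: kh morphism_eqs(4)[OF h] morphism_eqs(4)[OF morphism_quot])
  then have "cunt K \<cdot> k = cunt quot"
    by (rule epiD[OF epi_pi]) simp_all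
  moreover have "(k \<cdot> antip quot) \<cdot> \<pi> = (antip K \<cdot> k) \<cdot> \<pi>"
    by (simp add: kh morphism_eqs(5)[OF h] morphism_eqs(5)[OF morphism_quot, symmetric])
  then have "k \<cdot> antip quot = antip K \<cdot> k"
    by (rule epiD[OF epi_pi]) simp_all
  ultimately have "hopf_monoid_morphism M quot K k"
    using k by (simp add: hopf_monoid_morphism_def)
  moreover have "k' = k" if "hopf_monoid_morphism M quot K k'" "k' \<cdot> \<pi> = h" for k'
    by (rule epiD[OF epi_pi]) (use that kh morphism_arrs[OF that(1)] in simp_all)
  ultimately show ?thesis
    using kh by blast
qed

text \<open>Naturality moves the braiding past \<pi> \<otimes> \<pi> onto the comultiplication of
  \<open>B\<close>.\<close>

lemma cocommutative_quot:
  assumes "cocommutative M B"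
  shows "cocommutative M quot"
proof -
  have "(Br M Q Q \<cdot> cmulQ) \<cdot> \<pi> = (Br M Q Q \<cdot> (\<pi> \<otimes> \<pi>)) \<cdot> d"
    by (simp add: cmulQ(2))
  also have "\<dots> = (\<pi> \<otimes> \<pi>) \<cdot> (Br M b b \<cdot> d)"
    by (subst br_nat) simp_all
  also have "\<dots> = cmulQ \<cdot> \<pi>"
    using assms by (simp add: cocommutative_def cmulQ(2))
  finally have "Br M Q Q \<cdot> cmulQ = cmulQ"
    by (rule epiD[OF epi_pi]) simp_all
  then show ?thesis
    by (simp add: cocommutative_def quot_def)
qed

end

section \<open>The coequalizer of Hopf monoids\<close>

lemma hom_Hopf:
  "h \<in> hom (Hopf M) H K \<longleftrightarrow> Src h = H \<and> Tgt h = K \<and> hopf_monoid M H \<and> hopf_monoid M K \<and>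
    hopf_monoid_morphism M H K (Und h)"
  by (auto simp: hom_def Hopf_def)

lemma hom_full_subcategory:
  "h \<in> hom (full_subcategory C P) X Y \<longleftrightarrow> h \<in> hom C X Y \<and> P X \<and> P Y"
  by (auto simp: hom_def full_subcategory_def)

text \<open>Fullness keeps all arrows between the retained objects, so factorizations and their
  uniqueness are those of \<open>C\<close>.\<close>

lemma full_subcategory_coequalizer:
  assumes coeq: "is_coequalizer C f g q" and P: "P (Dom C f)" "P (Cod C f)" "P (Cod C q)"
  shows "is_coequalizer (full_subcategory C P) f g q"
proof -
  have [simp]: "Dom (full_subcategory C P) = Dom C" "Cod (full_subcategory C P) = Cod C"
    "Comp (full_subcategory C P) = Comp C"
    "Arr (full_subcategory C P) = {f \<in> Arr C. P (Dom C f) \<and> P (Cod C f)}"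
    by (simp_all add: full_subcategory_def)
  show ?thesis
    using coeq P unfolding is_coequalizer_def parallel_def hom_full_subcategory by auto
qed

text \<open>With source and target fixed, an arrow of \<open>Hopf M\<close> is determined by its
  underlying arrow, so factorizations reduce to \<open>factor_morphism\<close>.\<close>

lemma (in hopf_coequalizer) coequalizer_Hopf:
  "is_coequalizer (Hopf M) \<lparr>Src = A, Und = f, Tgt = B\<rparr> \<lparr>Src = A, Und = g, Tgt = B\<rparr>
    \<lparr>Src = B, Und = \<pi>, Tgt = quot\<rparr>"
  unfolding is_coequalizer_def
proof (intro conjI ballI impI)
  fix h assume "h \<in> Arr (Hopf M)"
    and "Dom (Hopf M) h = Cod (Hopf M) \<lparr>Src = A, Und = f, Tgt = B\<rparr> \<and>
      h \<cdot>\<^bsub>Hopf M\<^esub> \<lparr>Src = A, Und = f, Tgt = B\<rparr> = h \<cdot>\<^bsub>Hopf M\<^esub> \<lparr>Src = A, Und = g, Tgt = B\<rparr>"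
  then have h: "Src h = B" "hopf_monoid M (Tgt h)" "hopf_monoid_morphism M B (Tgt h) (Und h)"
    and eq: "Und h \<cdot> f = Und h \<cdot> g"
    by (auto simp: Hopf_def)
  obtain k where k: "hopf_monoid_morphism M quot (Tgt h) k" "k \<cdot> \<pi> = Und h"
    and uniq: "\<And>l. hopf_monoid_morphism M quot (Tgt h) l \<Longrightarrow> l \<cdot> \<pi> = Und h \<Longrightarrow> l = k"
    using factor_morphism[OF h(2,3) eq] by blast
  show "\<exists>!k. k \<in> hom (Hopf M) (Cod (Hopf M) \<lparr>Src = B, Und = \<pi>, Tgt = quot\<rparr>) (Cod (Hopf M) h) \<and>
      k \<cdot>\<^bsub>Hopf M\<^esub> \<lparr>Src = B, Und = \<pi>, Tgt = quot\<rparr> = h"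
  proof (rule ex1I[of _ "\<lparr>Src = quot, Und = k, Tgt = Tgt h\<rparr>"])
    show "\<lparr>Src = quot, Und = k, Tgt = Tgt h\<rparr> \<in> hom (Hopf M) (Cod (Hopf M) \<lparr>Src = B, Und =
      \<pi>, Tgt = quot\<rparr>) (Cod (Hopf M) h) \<and>
      \<lparr>Src = quot, Und = k, Tgt = Tgt h\<rparr> \<cdot>\<^bsub>Hopf M\<^esub> \<lparr>Src = B, Und = \<pi>, Tgt = quot\<rparr> = h"
      using k h hopf_quot unfolding hom_Hopf by (auto simp: Hopf_def intro: hopf_arrow.equality)
  next
    fix l assume "l \<in> hom (Hopf M) (Cod (Hopf M) \<lparr>Src = B, Und = \<pi>, Tgt = quot\<rparr>) (Cod (Hopf M) h) \<and>
      l \<cdot>\<^bsub>Hopf M\<^esub> \<lparr>Src = B, Und = \<pi>, Tgt = quot\<rparr> = h"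
    then have l: "Src l = quot" "Tgt l = Tgt h" "hopf_monoid_morphism M quot (Tgt h) (Und l)"
      "Und l \<cdot> \<pi> = Und h"
      unfolding hom_Hopf by (auto simp: Hopf_def)
    then show "l = \<lparr>Src = quot, Und = k, Tgt = Tgt h\<rparr>"
      using uniq by (intro hopf_arrow.equality) simp_all
  qed
qed (use A B f g hopf_quot morphism_quot pi_f in \<open>auto simp: Hopf_def parallel_def\<close>)

text \<open>The first conjunct justifies speaking of the unique Hopf structure for which \<pi> is a
  morphism; the second speaks of any such structure instead of naming one.\<close>

theorem proposition4p2:
  fixes M :: "('o, 'm) braided_data"
    and A B :: "('o, 'm) hopf_data"
    and f g :: "('o, 'm) hopf_arrow"
    and \<pi> :: 'm
  assumes "braided_monoidal_category M"
    and "has_equalizers M" and "tensor_preserves_equalizers M"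
    and "has_coequalizers M" and "tensor_preserves_coequalizers M"
    and "f \<in> hom (Hopf M) A B" and "g \<in> hom (Hopf M) A B"
    and "is_coequalizer M (phi M B (Und f)) (phi M B (Und g)) \<pi>"
  shows "(\<exists>!Q. Car Q = Cod M \<pi> \<and> \<lparr>Src = B, Und = \<pi>, Tgt = Q\<rparr> \<in> hom (Hopf M) B Q) \<and>
    (\<forall>Q. Car Q = Cod M \<pi> \<and> \<lparr>Src = B, Und = \<pi>, Tgt = Q\<rparr> \<in> hom (Hopf M) B Q \<longrightarrow>
      is_coequalizer (Hopf M) f g \<lparr>Src = B, Und = \<pi>, Tgt = Q\<rparr> \<and>
      (f \<in> hom (Hopf_coc M) A B \<and> g \<in> hom (Hopf_coc M) A B \<longrightarrow>
        is_coequalizer (Hopf_coc M) f g \<lparr>Src = B, Und = \<pi>, Tgt = Q\<rparr>))"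
proof -
  interpret braided_monoidal_category M
    by fact
  interpret hopf_coequalizer M A B "Und f" "Und g" \<pi>
    using assms by unfold_locales (auto simp: hom_Hopf)
  have fg: "f = \<lparr>Src = A, Und = Und f, Tgt = B\<rparr>" "g = \<lparr>Src = A, Und = Und g, Tgt = B\<rparr>"
    using assms(6,7) by (auto simp: hom_Hopf intro: hopf_arrow.equality)
  have coeq: "is_coequalizer (Hopf M) f g \<lparr>Src = B, Und = \<pi>, Tgt = quot\<rparr>"
    using coequalizer_Hopf fg by simp
  \<comment> \<open>The quotient is cocommutative along with \<open>B\<close>, so all three objects
    lie in the full subcategory.\<close>
  have coc: "is_coequalizer (Hopf_coc M) f g \<lparr>Src = B, Und = \<pi>, Tgt = quot\<rparr>"
    if "f \<in> hom (Hopf_coc M) A B"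
    unfolding Hopf_coc_def
  proof (rule full_subcategory_coequalizer[OF coeq])
    have AB: "cocommutative M A" "cocommutative M B"
      using that by (auto simp: Hopf_coc_def hom_full_subcategory)
    then show "cocommutative M (Dom (Hopf M) f)" "cocommutative M (Cod (Hopf M) f)"
      using assms(6) by (simp_all add: hom_def)
    show "cocommutative M (Cod (Hopf M) \<lparr>Src = B, Und = \<pi>, Tgt = quot\<rparr>)"
      using cocommutative_quot[OF AB(2)] by (simp add: Hopf_def)
  qed
  \<comment> \<open>The admissible structures are exactly \<open>quot\<close>, so both quantifiers
    over \<open>Q\<close> in the goal collapse.\<close>
  have iff: "Car H = Cod M \<pi> \<and> \<lparr>Src = B, Und = \<pi>, Tgt = H\<rparr> \<in> hom (Hopf M) B H \<longleftrightarrow> H = quot" for H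
  proof
    assume "Car H = Cod M \<pi> \<and> \<lparr>Src = B, Und = \<pi>, Tgt = H\<rparr> \<in> hom (Hopf M) B H"
    then show "H = quot"
      using quot_unique by (simp add: hom_Hopf)
  next
    have "Car quot = Cod M \<pi>"
      by (simp add: quot_def)
    then show "Car H = Cod M \<pi> \<and> \<lparr>Src = B, Und = \<pi>, Tgt = H\<rparr> \<in> hom (Hopf M) B H" if "H = quot"
      using that B hopf_quot morphism_quot by (simp add: hom_Hopf)
  qed
  show ?thesis
    unfolding iff using coeq coc by simp
qed

end
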